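(* Suppose $l\ge5$. The homogeneous ideal $I=\ker(S\to H^0(Z,\mathcal{O}_Z))$ of $S$ is generated by $\operatorname{tr}(M^2)$, $\operatorname{tr}(N^2)$, $\operatorname{tr}(MN)$ (in degree 2) and by $\operatorname{tr}(M^3)$, $\operatorname{tr}(N^3)$ and all entries of $M^2N$, $N^2M$, $NM^2$, $MN^2$ (in degree 3).
   Context: Let $\mathbb{F}$ be a field of characteristic $l$, $G=SL_3$ over $\mathbb{F}$, $B$ the upper triangular Borel subgroup, $\mathfrak{g}=\mathfrak{sl}_3$, $\mathfrak{n}$ the strictly upper triangular matrices. Let $Z=G\times^B(\mathfrak{n}\times\mathfrak{n})$, the total space of the vector bundle $\mathfrak{n}^2$ over $G/B$, and let $Z\to\mathfrak{g}\times\mathfrak{g}$ be $(g,(M,N))\mapsto(\mathrm{Ad}(g)M,\mathrm{Ad}(g)N)$. Let $S=\operatorname{Sym}((\mathfrak{g}^* )^2)$ be the (graded) coordinate ring of $\mathfrak{g}\times\mathfrak{g}$, with $(M,N)$ the universal pair of matrices over $S$, and $S\to H^0(Z,\mathcal{O}_Z)$ the induced graded ring map. *)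

theory Defs
  imports
    "HOL-Analysis.Determinants"
    "HOL-Algebra.QuotRing"
    "HOL-Algebra.Algebraic_Closure_Type"
    "HOL-Library.Poly_Mapping"
begin

no_notation fps_nth (infixl \<open>$\<close> 75) \<comment> \<open>clashes with matrix entries\<close>

section \<open>Polynomial rings\<close>

type_synonym ('v, 'a) mpoly = "('v \<Rightarrow>\<^sub>0 nat) \<Rightarrow>\<^sub>0 'a"

definition Var :: "'v \<Rightarrow> ('v, 'a::comm_ring_1) mpoly" where
  "Var v = Poly_Mapping.single (Poly_Mapping.single v 1) 1"

text \<open>The homomorphism of algebras over the coefficients that sends each variable \<open>v\<close> to \<open>\<sigma> v\<close>.\<close>

definition mon_subst :: "('v \<Rightarrow> ('w, 'a::comm_ring_1) mpoly) \<Rightarrow> ('v \<Rightarrow>\<^sub>0 nat) \<Rightarrow> ('w, 'a) mpoly" where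
  "mon_subst \<sigma> m = (\<Prod>v\<in>Poly_Mapping.keys m. \<sigma> v ^ Poly_Mapping.lookup m v)"

definition subst :: "('v \<Rightarrow> ('w, 'a::comm_ring_1) mpoly) \<Rightarrow> ('v, 'a) mpoly \<Rightarrow> ('w, 'a) mpoly" where
  "subst \<sigma> p =
    (\<Sum>m\<in>Poly_Mapping.keys p. Poly_Mapping.single 0 (Poly_Mapping.lookup p m) * mon_subst \<sigma> m)"

definition mon_degree :: "('v \<Rightarrow>\<^sub>0 nat) \<Rightarrow> nat" where
  "mon_degree m = (\<Sum>v\<in>Poly_Mapping.keys m. Poly_Mapping.lookup m v)"

definition graded_piece :: "nat \<Rightarrow> ('v, 'a::comm_ring_1) mpoly set" where
  "graded_piece d = {p. \<forall>m\<in>Poly_Mapping.keys p. mon_degree m = d}"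

definition homogeneous_component ::
    "nat \<Rightarrow> ('v, 'a::comm_ring_1) mpoly \<Rightarrow> ('v, 'a) mpoly" where
  "homogeneous_component d p =
    (\<Sum>m | m \<in> Poly_Mapping.keys p \<and> mon_degree m = d.
      Poly_Mapping.single m (Poly_Mapping.lookup p m))"

definition homogeneous_ideal :: "('v, 'a::comm_ring_1) mpoly set \<Rightarrow> bool" where
  "homogeneous_ideal I \<longleftrightarrow>
    ideal I ring_of_type_algebra \<and> (\<forall>p\<in>I. \<forall>d. homogeneous_component d p \<in> I)"

text \<open>The map \<open>R Quot I \<rightarrow> R' Quot J\<close> induced by \<open>f : R \<rightarrow> R'\<close> (when \<open>f\<close> maps \<open>I\<close> into \<open>J\<close>).\<close>

definition quot_map :: "('b, 'm) ring_scheme \<Rightarrow> 'b set \<Rightarrow> ('a \<Rightarrow> 'b) \<Rightarrow> 'a set \<Rightarrow> 'b set" where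
  "quot_map R' J f C = (\<Union>p\<in>C. a_r_coset R' J (f p))"

lemma subst_superset:
  assumes "finite A" "Poly_Mapping.keys p \<subseteq> A"
  shows "subst \<sigma> p = (\<Sum>m\<in>A. Poly_Mapping.single 0 (Poly_Mapping.lookup p m) * mon_subst \<sigma> m)"
  unfolding subst_def using assms
  by (intro sum.mono_neutral_left) (auto simp: in_keys_iff)

lemma mon_subst_superset:
  assumes "finite A" "Poly_Mapping.keys m \<subseteq> A"
  shows "mon_subst \<sigma> m = (\<Prod>v\<in>A. \<sigma> v ^ Poly_Mapping.lookup m v)"
  unfolding mon_subst_def using assms
  by (intro prod.mono_neutral_left) (auto simp: in_keys_iff)

lemma mon_subst_add: "mon_subst \<sigma> (m + m') = mon_subst \<sigma> m * mon_subst \<sigma> m'"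
proof -
  let ?A = "Poly_Mapping.keys m \<union> Poly_Mapping.keys m'"
  have "finite ?A" by simp
  then show ?thesis
    using keys_add[of m m']
    by (simp add: mon_subst_superset[of ?A] lookup_add power_add prod.distrib)
qed

lemma subst_add: "subst \<sigma> (p + q) = subst \<sigma> p + subst \<sigma> q"
proof -
  let ?A = "Poly_Mapping.keys p \<union> Poly_Mapping.keys q"
  have "finite ?A" by simp
  then show ?thesis
    using keys_add[of p q]
    by (simp add: subst_superset[of ?A] lookup_add single_add distrib_right sum.distrib)
qed

lemma subst_0: "subst \<sigma> 0 = 0"
  by (simp add: subst_def)

lemma subst_uminus: "subst \<sigma> (- p) = - subst \<sigma> p"
  using subst_add[of \<sigma> p "- p"] by (simp add: subst_0 eq_neg_iff_add_eq_0 add.commute)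

lemma subst_diff: "subst \<sigma> (p - q) = subst \<sigma> p - subst \<sigma> q"
  using subst_add[of \<sigma> p "- q"] by (simp add: subst_uminus)

lemma subst_sum: "subst \<sigma> (\<Sum>i\<in>A. f i) = (\<Sum>i\<in>A. subst \<sigma> (f i))"
  by (induction A rule: infinite_finite_induct) (auto simp: subst_add subst_0)

lemma subst_single:
  "subst \<sigma> (Poly_Mapping.single m c) = Poly_Mapping.single 0 c * mon_subst \<sigma> m"
  by (cases "c = 0") (auto simp: subst_def)

lemma subst_1: "subst \<sigma> 1 = 1"
  using subst_single[of \<sigma> 0 1] by (simp add: mon_subst_def)

lemma mpoly_expansion:
  "p = (\<Sum>m\<in>Poly_Mapping.keys p. Poly_Mapping.single m (Poly_Mapping.lookup p m))"
proof (rule poly_mapping_eqI)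
  fix k
  show "Poly_Mapping.lookup p k = Poly_Mapping.lookup
      (\<Sum>m\<in>Poly_Mapping.keys p. Poly_Mapping.single m (Poly_Mapping.lookup p m)) k"
    by (simp add: lookup_sum lookup_single when_def sum.delta in_keys_iff)
qed

lemma subst_mult:
  fixes \<sigma> :: "'v \<Rightarrow> ('w, 'a::comm_ring_1) mpoly"
  shows "subst \<sigma> (p * q) = subst \<sigma> p * subst \<sigma> q"
proof -
  have *: "subst \<sigma> (Poly_Mapping.single m c * Poly_Mapping.single m' c')
      = subst \<sigma> (Poly_Mapping.single m c) * subst \<sigma> (Poly_Mapping.single m' c')" for m m' c c'
  proof -
    have "Poly_Mapping.single 0 (c * c') * P =
        Poly_Mapping.single 0 c * (Poly_Mapping.single 0 c' * P)" for P :: "('w, 'a) mpoly"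
      by (simp add: mult_single flip: mult.assoc)
    then show ?thesis
      unfolding mult_single[of m] subst_single mon_subst_add by (simp add: mult.left_commute mult.assoc)
  qed
  show ?thesis
    apply (subst mpoly_expansion[of p], subst mpoly_expansion[of q])
    apply (subst (3) mpoly_expansion[of p], subst (3) mpoly_expansion[of q])
    apply (simp add: sum_product subst_sum *)
    done
qed

lemma subst_Var [simp]: "subst \<sigma> (Var v) = \<sigma> v"
  by (simp add: Var_def subst_single mon_subst_def)

lemma prod_single:
  "finite A \<Longrightarrow> (\<Prod>v\<in>A. Poly_Mapping.single (f v) (1::'a::comm_ring_1)) = Poly_Mapping.single (\<Sum>v\<in>A. f v) 1"
  by (induction A rule: finite_induct) (auto simp: mult_single)

lemma Var_power: "Var v ^ n = Poly_Mapping.single (Poly_Mapping.single v n) 1"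
  by (induction n) (auto simp: Var_def mult_single simp flip: single_add)

lemma mon_subst_Var: "mon_subst Var m = Poly_Mapping.single m 1"
proof -
  have "(\<Sum>v\<in>Poly_Mapping.keys m. Poly_Mapping.single v (Poly_Mapping.lookup m v)) = m"
    by (rule poly_mapping_eqI) (simp add: lookup_sum lookup_single when_def sum.delta in_keys_iff)
  then show ?thesis
    by (simp add: mon_subst_def Var_power prod_single)
qed

lemma mpoly_induct [case_names const Var add mult]:
  fixes p :: "('v, 'a::comm_ring_1) mpoly"
  assumes const: "\<And>c. P (Poly_Mapping.single 0 c)" and Var: "\<And>v. P (Var v)"
    and add: "\<And>p q. P p \<Longrightarrow> P q \<Longrightarrow> P (p + q)" and mult: "\<And>p q. P p \<Longrightarrow> P q \<Longrightarrow> P (p * q)"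
  shows "P p"
proof -
  have P0: "P 0" and P1: "P 1" using const[of 0] const[of 1] by simp_all
  have pw: "P (Var v ^ n)" for v n by (induction n) (auto intro: P1 Var mult)
  have pr: "P (\<Prod>v\<in>A. Var v ^ f v)" for A and f :: "'v \<Rightarrow> nat"
    by (induction A rule: infinite_finite_induct) (auto intro: P1 pw mult)
  have mono: "P (Poly_Mapping.single m c)" for m c
  proof -
    have "Poly_Mapping.single m c = Poly_Mapping.single 0 c * mon_subst Var m"
      by (simp add: mon_subst_Var mult_single)
    then show ?thesis using mult[OF const pr] by (simp add: mon_subst_def)
  qed
  have "P (\<Sum>m\<in>A. Poly_Mapping.single m (f m))" for A f
    by (induction A rule: infinite_finite_induct) (auto intro: P0 mono add)
  then show ?thesis by (subst mpoly_expansion)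
qed

lemma subst_const: "subst \<sigma> (Poly_Mapping.single 0 c) = Poly_Mapping.single 0 c"
  by (simp add: subst_single mon_subst_def)

lemma subst_subst: "subst \<sigma> (subst \<tau> p) = subst (\<lambda>v. subst \<sigma> (\<tau> v)) p"
  by (induction p rule: mpoly_induct) (simp_all add: subst_const subst_add subst_mult)


text \<open>Ideals and quotients of rings given by types.\<close>

lemma ring_of_type_simps [simp]:
  "carrier ring_of_type_algebra = UNIV" "x \<otimes>\<^bsub>ring_of_type_algebra\<^esub> y = x * y"
  "\<one>\<^bsub>ring_of_type_algebra\<^esub> = 1" "\<zero>\<^bsub>ring_of_type_algebra\<^esub> = 0"
  "x \<oplus>\<^bsub>ring_of_type_algebra\<^esub> y = x + y"
  by (simp_all add: ring_of_type_algebra_def)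

lemma type_ideal_closed:
  fixes J :: "'r::comm_ring_1 set"
  assumes "ideal J ring_of_type_algebra"
  shows "0 \<in> J" "x \<in> J \<Longrightarrow> y \<in> J \<Longrightarrow> x + y \<in> J" "x \<in> J \<Longrightarrow> a * x \<in> J" "x \<in> J \<Longrightarrow> x * a \<in> J"
    "x \<in> J \<Longrightarrow> - x \<in> J" "x \<in> J \<Longrightarrow> y \<in> J \<Longrightarrow> x - y \<in> J"
proof -
  interpret ideal J "ring_of_type_algebra :: 'r ring" by fact
  show "0 \<in> J" using additive_subgroup.zero_closed[OF additive_subgroup_axioms] by simp
  show add: "x + y \<in> J" if "x \<in> J" "y \<in> J" for x y using additive_subgroup.a_closed[OF additive_subgroup_axioms that] by simp
  show l: "a * x \<in> J" if "x \<in> J" for a x using I_l_closed[OF that, of a] by simp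
  show "x * a \<in> J" if "x \<in> J" for a x using I_r_closed[OF that, of a] by simp
  show um: "- x \<in> J" if "x \<in> J" for x using l[OF that, of "-1"] by simp
  show "x - y \<in> J" if "x \<in> J" "y \<in> J" for x y using add[OF that(1) um[OF that(2)]] by simp
qed

lemma type_idealI:
  fixes J :: "'r::comm_ring_1 set"
  assumes "0 \<in> J" "\<And>x y. x \<in> J \<Longrightarrow> y \<in> J \<Longrightarrow> x + y \<in> J" "\<And>a x. x \<in> J \<Longrightarrow> a * x \<in> J"
  shows "ideal J ring_of_type_algebra"
proof (rule idealI)
  show "ring (ring_of_type_algebra :: 'r ring)" by (rule ring_from_type_algebra)
  then interpret ring "ring_of_type_algebra :: 'r ring" .
  show "subgroup J (add_monoid ring_of_type_algebra)"
  proof (rule add.subgroupI)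
    fix a assume "a \<in> J"
    have "\<ominus>\<^bsub>ring_of_type_algebra\<^esub> a = - a"
      by (rule minus_equality) auto
    then show "\<ominus>\<^bsub>ring_of_type_algebra\<^esub> a \<in> J" using assms(3)[OF \<open>a \<in> J\<close>, of "-1"] by simp
  qed (use assms in auto)
qed (use assms in \<open>auto simp: mult.commute\<close>)

lemma ideal_genideal:
  "ideal (genideal ring_of_type_algebra (A :: 'r::comm_ring_1 set)) ring_of_type_algebra"
  by (rule ring.genideal_ideal[OF ring_from_type_algebra]) simp

lemma coset_eq_iff:
  fixes J :: "'r::comm_ring_1 set"
  assumes "ideal J ring_of_type_algebra"
  shows "a_r_coset ring_of_type_algebra J p = a_r_coset ring_of_type_algebra J q \<longleftrightarrow> p - q \<in> J"
proof -
  note c = type_ideal_closed[OF assms]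
  have *: "a_r_coset ring_of_type_algebra J p = {x. x - p \<in> J}" for p :: 'r
    by (force simp: a_r_coset_def' intro: exI[of _ "_ - p"])
  show ?thesis
  proof
    assume "a_r_coset ring_of_type_algebra J p = a_r_coset ring_of_type_algebra J q"
    then show "p - q \<in> J" using c(1) by (force simp: *)
  next
    assume d: "p - q \<in> J"
    show "a_r_coset ring_of_type_algebra J p = a_r_coset ring_of_type_algebra J q"
      unfolding * using c(2)[OF _ d] c(6)[OF _ d] by (fastforce simp: algebra_simps)
  qed
qed

lemma subst_genideal:
  assumes "ideal J ring_of_type_algebra" "\<And>x. x \<in> A \<Longrightarrow> subst \<sigma> x \<in> J"
    "x \<in> genideal ring_of_type_algebra A"
  shows "subst \<sigma> x \<in> J"
proof -
  note c = type_ideal_closed[OF assms(1)]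
  have "ideal {x. subst \<sigma> x \<in> J} ring_of_type_algebra"
    by (rule type_idealI) (auto simp: subst_add subst_mult subst_0 c)
  from ring.genideal_minimal[OF ring_from_type_algebra this, of A] assms(2,3) show ?thesis
    by auto
qed

lemma subst_cong_ideal:
  assumes J: "ideal J ring_of_type_algebra" and "\<And>v. \<sigma> v - \<tau> v \<in> J"
  shows "subst \<sigma> p - subst \<tau> p \<in> J"
proof (induction p rule: mpoly_induct)
  case (add p q)
  then show ?case using type_ideal_closed(2)[OF J add] by (simp add: subst_add algebra_simps)
next
  case (mult p q)
  have "subst \<sigma> (p * q) - subst \<tau> (p * q) =
      (subst \<sigma> p - subst \<tau> p) * subst \<sigma> q + subst \<tau> p * (subst \<sigma> q - subst \<tau> q)"
    by (simp add: subst_mult algebra_simps)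
  then show ?case using mult type_ideal_closed[OF J] by simp
qed (simp_all add: assms subst_const type_ideal_closed[OF J])

lemma quot_map_coset:
  assumes I: "ideal I ring_of_type_algebra" and J: "ideal J ring_of_type_algebra"
    and IJ: "\<And>x. x \<in> I \<Longrightarrow> subst \<sigma> x \<in> J"
  shows "quot_map ring_of_type_algebra J (subst \<sigma>) (a_r_coset ring_of_type_algebra I p)
       = a_r_coset ring_of_type_algebra J (subst \<sigma> p)"
proof -
  have "a_r_coset ring_of_type_algebra J (subst \<sigma> q) = a_r_coset ring_of_type_algebra J (subst \<sigma> p)"
    if "q \<in> a_r_coset ring_of_type_algebra I p" for q
  proof -
    from that obtain h where "h \<in> I" "q = h + p" by (auto simp: a_r_coset_def')
    then show ?thesis using IJ by (simp add: coset_eq_iff[OF J] subst_add)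
  qed
  moreover have "p \<in> a_r_coset ring_of_type_algebra I p"
    using type_ideal_closed(1)[OF I] by (force simp: a_r_coset_def')
  ultimately show ?thesis unfolding quot_map_def by blast
qed


section \<open>Matrices and coordinates\<close>

text \<open>
  In a matrix \<open>(x\<^sub>i\<^sub>j)\<close> of \<open>sl\<^sub>3\<close> the entry \<open>x\<^sub>3\<^sub>3\<close> equals
  \<open>- x\<^sub>1\<^sub>1 - x\<^sub>2\<^sub>2\<close>; the other eight entries form a basis of the dual space of \<open>sl\<^sub>3\<close>,
  in every characteristic.
\<close>

datatype sl3_coord = X11 | X12 | X13 | X21 | X22 | X23 | X31 | X32
datatype n_coord = N12 | N13 | N23
datatype b_coord = B11 | B12 | B13 | B22 | B23 | B33

definition sl3_matrix :: "(sl3_coord \<Rightarrow> 'r::comm_ring_1) \<Rightarrow> 'r^3^3" where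
  "sl3_matrix x = vector [vector [x X11, x X12, x X13],
                          vector [x X21, x X22, x X23],
                          vector [x X31, x X32, - x X11 - x X22]]"

definition n_matrix :: "(n_coord \<Rightarrow> 'r::comm_ring_1) \<Rightarrow> 'r^3^3" where
  "n_matrix x = vector [vector [0, x N12, x N13],
                        vector [0, 0, x N23],
                        vector [0, 0, 0]]"

definition b_matrix :: "(b_coord \<Rightarrow> 'r::comm_ring_1) \<Rightarrow> 'r^3^3" where
  "b_matrix x = vector [vector [x B11, x B12, x B13],
                        vector [0, x B22, x B23],
                        vector [0, 0, x B33]]"

primrec sl3_entry :: "'r^3^3 \<Rightarrow> sl3_coord \<Rightarrow> 'r" where
  "sl3_entry A X11 = A$1$1" | "sl3_entry A X12 = A$1$2" | "sl3_entry A X13 = A$1$3"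
| "sl3_entry A X21 = A$2$1" | "sl3_entry A X22 = A$2$2" | "sl3_entry A X23 = A$2$3"
| "sl3_entry A X31 = A$3$1" | "sl3_entry A X32 = A$3$2"

primrec n_entry :: "'r^3^3 \<Rightarrow> n_coord \<Rightarrow> 'r" where
  "n_entry A N12 = A$1$2" | "n_entry A N13 = A$1$3" | "n_entry A N23 = A$2$3"

text \<open>The transposed cofactor matrix, which is the inverse of a matrix of determinant 1.\<close>

definition adjugate :: "('r::comm_ring_1)^3^3 \<Rightarrow> 'r^3^3" where
  "adjugate A = (\<chi> i j. det (\<chi> k l.
      if k = j \<and> l = i then 1 else if k = j \<or> l = i then 0 else A$k$l))"

lemma matrix3_eq_iff:
  fixes A B :: "'r^3^3"
  shows "A = B \<longleftrightarrow> A$1$1 = B$1$1 \<and> A$1$2 = B$1$2 \<and> A$1$3 = B$1$3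
                 \<and> A$2$1 = B$2$1 \<and> A$2$2 = B$2$2 \<and> A$2$3 = B$2$3
                 \<and> A$3$1 = B$3$1 \<and> A$3$2 = B$3$2 \<and> A$3$3 = B$3$3"
  by (auto simp: vec_eq_iff forall_3)

lemma idx3:
  "(1::3) \<noteq> 2" "(1::3) \<noteq> 3" "(2::3) \<noteq> 3" "(2::3) \<noteq> 1" "(3::3) \<noteq> 1" "(3::3) \<noteq> 2"
  by auto

lemma adjugate_entries:
  "adjugate A $1$1 = A$2$2*A$3$3 - A$2$3*A$3$2"
  "adjugate A $1$2 = A$1$3*A$3$2 - A$1$2*A$3$3"
  "adjugate A $1$3 = A$1$2*A$2$3 - A$1$3*A$2$2"
  "adjugate A $2$1 = A$2$3*A$3$1 - A$2$1*A$3$3"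
  "adjugate A $2$2 = A$1$1*A$3$3 - A$1$3*A$3$1"
  "adjugate A $2$3 = A$1$3*A$2$1 - A$1$1*A$2$3"
  "adjugate A $3$1 = A$2$1*A$3$2 - A$2$2*A$3$1"
  "adjugate A $3$2 = A$1$2*A$3$1 - A$1$1*A$3$2"
  "adjugate A $3$3 = A$1$1*A$2$2 - A$1$2*A$2$1"
  by (simp_all only: adjugate_def vec_lambda_beta det_3 idx3 if_True if_False simp_thms
      mult_zero_left mult_zero_right mult_1_left mult_1_right add_0_left add_0_right
      diff_0 diff_0_right)

lemma adjugate_inverse:
  fixes A :: "('r::comm_ring_1)^3^3"
  shows "A ** adjugate A = mat (det A)" "adjugate A ** A = mat (det A)"
  unfolding matrix3_eq_iff
  by (simp_all only: matrix_matrix_mult_def vec_lambda_beta sum_3 mat_def det_3 adjugate_entries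
      idx3 refl if_True if_False) (simp_all only: algebra_simps add_0_left)

lemma adjugate_mult: "adjugate (A ** B) = adjugate B ** adjugate A"
  unfolding matrix3_eq_iff
  by (simp_all only: matrix_matrix_mult_def vec_lambda_beta sum_3 adjugate_entries)
     (simp_all only: algebra_simps)


section \<open>The rings \<open>S\<close> and \<open>H\<^sup>0(Z, O\<^sub>Z)\<close>\<close>

text \<open>
  \<open>S = Sym((g\<^sup>*)\<^sup>2)\<close>; the left summand carries the coordinates of \<open>M\<close>, the right one those of \<open>N\<close>.
\<close>

type_synonym 'f S = "(sl3_coord + sl3_coord, 'f) mpoly"

abbreviation S_ring :: "('f::comm_ring_1) S ring" where
  "S_ring \<equiv> ring_of_type_algebra"

definition univ_M :: "('f::comm_ring_1) S^3^3" where
  "univ_M = sl3_matrix (\<lambda>e. Var (Inl e))"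

definition univ_N :: "('f::comm_ring_1) S^3^3" where
  "univ_N = sl3_matrix (\<lambda>e. Var (Inr e))"

text \<open>
  Coordinates on \<open>G \<times> n \<times> n\<close>, and on \<open>(G \<times> n \<times> n) \<times> B\<close>. Since \<open>Z\<close> is the quotient of
  \<open>G \<times> n \<times> n\<close> by the free right action
  \<open>(g, (U, V)) \<cdot> b = (g b, (b\<^sup>-\<^sup>1 U b, b\<^sup>-\<^sup>1 V b))\<close> of \<open>B\<close>, the ring \<open>H\<^sup>0(Z, O\<^sub>Z)\<close> is the ring of
  \<open>B\<close>-invariant functions on \<open>G \<times> n \<times> n\<close>. Invariance is meant scheme-theoretically (the ground
  field may be finite): the pullbacks along the action and along the projection
  \<open>(G \<times> n \<times> n) \<times> B \<rightarrow> G \<times> n \<times> n\<close> agree.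
\<close>

datatype gnn_coord = G_entry 3 3 | U_entry n_coord | V_entry n_coord

type_synonym 'f gnn_poly = "(gnn_coord, 'f) mpoly"
type_synonym 'f gnnb_poly = "(gnn_coord + b_coord, 'f) mpoly"

definition gnn_g :: "('f::comm_ring_1) gnn_poly^3^3" where
  "gnn_g = (\<chi> i j. Var (G_entry i j))"

definition gnn_U :: "('f::comm_ring_1) gnn_poly^3^3" where
  "gnn_U = n_matrix (\<lambda>e. Var (U_entry e))"

definition gnn_V :: "('f::comm_ring_1) gnn_poly^3^3" where
  "gnn_V = n_matrix (\<lambda>e. Var (V_entry e))"

definition gnnb_g :: "('f::comm_ring_1) gnnb_poly^3^3" where
  "gnnb_g = (\<chi> i j. Var (Inl (G_entry i j)))"

definition gnnb_U :: "('f::comm_ring_1) gnnb_poly^3^3" where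
  "gnnb_U = n_matrix (\<lambda>e. Var (Inl (U_entry e)))"

definition gnnb_V :: "('f::comm_ring_1) gnnb_poly^3^3" where
  "gnnb_V = n_matrix (\<lambda>e. Var (Inl (V_entry e)))"

definition gnnb_b :: "('f::comm_ring_1) gnnb_poly^3^3" where
  "gnnb_b = b_matrix (\<lambda>e. Var (Inr e))"

definition gnn_ideal :: "('f::comm_ring_1) gnn_poly set" where
  "gnn_ideal = genideal ring_of_type_algebra {det gnn_g - 1}"

definition gnnb_ideal :: "('f::comm_ring_1) gnnb_poly set" where
  "gnnb_ideal = genideal ring_of_type_algebra {det gnnb_g - 1, det gnnb_b - 1}"

definition O_gnn :: "('f::comm_ring_1) gnn_poly set ring" where
  "O_gnn = ring_of_type_algebra Quot gnn_ideal"

definition O_gnnb :: "('f::comm_ring_1) gnnb_poly set ring" where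
  "O_gnnb = ring_of_type_algebra Quot gnnb_ideal"

primrec act_coord :: "gnn_coord \<Rightarrow> ('f::comm_ring_1) gnnb_poly" where
  "act_coord (G_entry i j) = (gnnb_g ** gnnb_b)$i$j"
| "act_coord (U_entry e) = n_entry (adjugate gnnb_b ** gnnb_U ** gnnb_b) e"
| "act_coord (V_entry e) = n_entry (adjugate gnnb_b ** gnnb_V ** gnnb_b) e"

definition proj_coord :: "gnn_coord \<Rightarrow> ('f::comm_ring_1) gnnb_poly" where
  "proj_coord v = Var (Inl v)"

definition act_pullback :: "('f::comm_ring_1) gnn_poly set \<Rightarrow> 'f gnnb_poly set" where
  "act_pullback = quot_map ring_of_type_algebra gnnb_ideal (subst act_coord)"

definition proj_pullback :: "('f::comm_ring_1) gnn_poly set \<Rightarrow> 'f gnnb_poly set" where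
  "proj_pullback = quot_map ring_of_type_algebra gnnb_ideal (subst proj_coord)"

definition H0_Z :: "('f::comm_ring_1) gnn_poly set ring" where
  "H0_Z = O_gnn \<lparr>carrier := {\<phi> \<in> carrier O_gnn. act_pullback \<phi> = proj_pullback \<phi>}\<rparr>"

text \<open>Pullback along \<open>(g, (U, V)) \<mapsto> (g U g\<^sup>-\<^sup>1, g V g\<^sup>-\<^sup>1)\<close>.\<close>

primrec Ad_coord :: "sl3_coord + sl3_coord \<Rightarrow> ('f::comm_ring_1) gnn_poly" where
  "Ad_coord (Inl e) = sl3_entry (gnn_g ** gnn_U ** adjugate gnn_g) e"
| "Ad_coord (Inr e) = sl3_entry (gnn_g ** gnn_V ** adjugate gnn_g) e"

definition S_to_H0 :: "('f::comm_ring_1) S \<Rightarrow> 'f gnn_poly set" where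
  "S_to_H0 f = a_r_coset ring_of_type_algebra gnn_ideal (subst Ad_coord f)"

text \<open>
  The pullback takes values in the invariants: \<open>S_to_H0\<close> is a ring homomorphism into \<open>H0_Z\<close>.
\<close>

lemma rel_in_gnnb_ideal: "det gnnb_g - 1 \<in> gnnb_ideal" "det gnnb_b - 1 \<in> gnnb_ideal"
  unfolding gnnb_ideal_def
  by (auto intro: subsetD[OF ring.genideal_self[OF ring_from_type_algebra]])

lemma ideal_gnn_ideal: "ideal (gnn_ideal :: 'f::comm_ring_1 gnn_poly set) ring_of_type_algebra"
  unfolding gnn_ideal_def by (rule ideal_genideal)

lemma ideal_gnnb_ideal: "ideal (gnnb_ideal :: 'f::comm_ring_1 gnnb_poly set) ring_of_type_algebra"
  unfolding gnnb_ideal_def by (rule ideal_genideal)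

definition map_matrix3 :: "('a \<Rightarrow> 'b) \<Rightarrow> 'a^3^3 \<Rightarrow> 'b^3^3" where
  "map_matrix3 f A = (\<chi> i j. f (A$i$j))"

lemma map_matrix3_subst:
  "map_matrix3 (subst \<sigma>) (A ** B) = map_matrix3 (subst \<sigma>) A ** map_matrix3 (subst \<sigma>) B"
  "map_matrix3 (subst \<sigma>) (adjugate A) = adjugate (map_matrix3 (subst \<sigma>) A)"
  "subst \<sigma> (det A) = det (map_matrix3 (subst \<sigma>) A)"
  "subst \<sigma> (sl3_entry A e) = sl3_entry (map_matrix3 (subst \<sigma>) A) e"
  by (simp add: map_matrix3_def matrix_matrix_mult_def subst_sum subst_mult vec_eq_iff,
      simp add: matrix3_eq_iff map_matrix3_def adjugate_entries subst_diff subst_mult,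
      simp add: map_matrix3_def det_3 subst_add subst_diff subst_mult,
      cases e, simp_all add: map_matrix3_def)

lemma vector3_nth [simp]:
  "(vector [x, y, z] :: 'a::zero^3) $ 1 = x" "(vector [x, y, z] :: 'a::zero^3) $ 2 = y"
  "(vector [x, y, z] :: 'a::zero^3) $ 3 = z"
  by (simp_all add: vector_def)

lemma map_act:
  "map_matrix3 (subst act_coord) gnn_g = gnnb_g ** gnnb_b"
  "map_matrix3 (subst act_coord) gnn_U = adjugate gnnb_b ** gnnb_U ** gnnb_b"
  "map_matrix3 (subst act_coord) gnn_V = adjugate gnnb_b ** gnnb_V ** gnnb_b"
  by (simp add: map_matrix3_def gnn_g_def vec_eq_iff,
      simp_all add: matrix3_eq_iff map_matrix3_def gnn_U_def gnn_V_def n_matrix_def subst_0)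
     (simp_all add: matrix_matrix_mult_def sum_3 adjugate_entries gnnb_b_def b_matrix_def
       gnnb_U_def gnnb_V_def n_matrix_def)

lemma map_proj:
  "map_matrix3 (subst proj_coord) gnn_g = gnnb_g"
  "map_matrix3 (subst proj_coord) gnn_U = gnnb_U"
  "map_matrix3 (subst proj_coord) gnn_V = gnnb_V"
  by (simp add: map_matrix3_def gnn_g_def gnnb_g_def proj_coord_def vec_eq_iff,
      simp_all add: matrix3_eq_iff map_matrix3_def gnn_U_def gnn_V_def gnnb_U_def gnnb_V_def
       n_matrix_def subst_0 proj_coord_def)

lemma act_coord_ideal: "x \<in> gnn_ideal \<Longrightarrow> subst act_coord x \<in> gnnb_ideal"
proof (rule subst_genideal[OF ideal_gnnb_ideal])
  note c = type_ideal_closed[OF ideal_gnnb_ideal]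
  fix x :: "'a gnn_poly" assume "x \<in> {det gnn_g - 1}"
  then have x: "x = det gnn_g - 1" by simp
  have "subst act_coord x =
      (det gnnb_g - 1) * det gnnb_b + (det gnnb_b - 1)"
    unfolding x by (simp add: subst_diff subst_1 map_matrix3_subst map_act det_mul algebra_simps)
  then show "subst act_coord x \<in> gnnb_ideal"
    by (simp add: c rel_in_gnnb_ideal)
qed (simp add: gnn_ideal_def)

lemma proj_coord_ideal: "x \<in> gnn_ideal \<Longrightarrow> subst proj_coord x \<in> gnnb_ideal"
proof (rule subst_genideal[OF ideal_gnnb_ideal])
  fix x :: "'a gnn_poly" assume "x \<in> {det gnn_g - 1}"
  then show "subst proj_coord x \<in> gnnb_ideal"
    by (simp add: subst_diff subst_1 map_matrix3_subst map_proj rel_in_gnnb_ideal)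
qed (simp add: gnn_ideal_def)

lemma mat_mult: "(A :: ('r::comm_ring_1)^3^3) ** mat d = (\<chi> i j. d * A$i$j)"
  "mat d ** (A :: ('r::comm_ring_1)^3^3) = (\<chi> i j. d * A$i$j)"
  by (simp_all add: matrix_matrix_mult_def mat_def vec_eq_iff if_distrib if_distribR
      sum.delta sum.delta' mult.commute cong: if_cong)

lemma Ad_cancel:
  fixes g b W :: "('r::comm_ring_1)^3^3"
  shows "(g ** b) ** (adjugate b ** W ** b) ** adjugate (g ** b)
    = (\<chi> i j. det b * det b * (g ** W ** adjugate g)$i$j)"
proof -
  have "(g ** b) ** (adjugate b ** W ** b) ** adjugate (g ** b)
      = (g ** (b ** adjugate b)) ** W ** ((b ** adjugate b) ** adjugate g)"
    by (simp only: adjugate_mult matrix_mul_assoc)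
  also have "\<dots> = (\<chi> i j. det b * g$i$j) ** W ** (\<chi> i j. det b * adjugate g$i$j)"
    by (simp only: adjugate_inverse mat_mult)
  also have "\<dots> = (\<chi> i j. det b * det b * (g ** W ** adjugate g)$i$j)"
    by (simp add: vec_eq_iff matrix_matrix_mult_def sum_3 algebra_simps)
  finally show ?thesis .
qed

lemma Ad_coord_invariant: "subst act_coord (Ad_coord v) - subst proj_coord (Ad_coord v) \<in> gnnb_ideal"
proof -
  note c = type_ideal_closed[OF ideal_gnnb_ideal]
  have *: "sl3_entry (\<chi> i j. d * d * A$i$j) e - sl3_entry A e
      = (d - 1) * ((d + 1) * sl3_entry A e)" for d :: "'a gnnb_poly" and A e
    by (cases e) (simp_all add: algebra_simps)
  show ?thesis
    by (cases v) (simp_all only: Ad_coord.simps map_matrix3_subst map_act map_proj Ad_cancel *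
        c(4)[OF rel_in_gnnb_ideal(2)])
qed

lemma S_to_H0_hom: "S_to_H0 \<in> ring_hom S_ring H0_Z"
proof -
  let ?C = "a_r_coset ring_of_type_algebra gnn_ideal"
  have hom: "?C \<in> ring_hom ring_of_type_algebra O_gnn"
    unfolding O_gnn_def by (rule ideal.rcos_ring_hom[OF ideal_gnn_ideal])
  have inv: "act_pullback (?C (subst Ad_coord f)) = proj_pullback (?C (subst Ad_coord f))" for f
    by (simp add: act_pullback_def proj_pullback_def subst_subst
        quot_map_coset[OF ideal_gnn_ideal ideal_gnnb_ideal]
        act_coord_ideal proj_coord_ideal coset_eq_iff[OF ideal_gnnb_ideal]
        subst_cong_ideal[OF ideal_gnnb_ideal Ad_coord_invariant])
  show ?thesis
    using hom by (auto simp: ring_hom_def H0_Z_def S_to_H0_def inv subst_add subst_mult subst_1)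
qed

end

theory Submission
  imports Defs
begin

text \<open>
  The listed elements vanish on the image because a product of three strictly upper triangular
  matrices is zero. Conversely, let \<open>J\<close> be the ideal that they generate and let \<open>f\<close> be the upper
  right entry of \<open>N\<^sup>2\<close>. Where \<open>f\<close> is invertible the flag can be read off from \<open>N\<^sup>2\<close>, and modulo
  \<open>J\<close> the pair \<open>(M, N)\<close> comes from \<open>G \<times> n \<times> n\<close>; so every \<open>p \<in> I\<close> lies in the ideal of
  \<open>S[t]\<close> generated by \<open>J\<close> and \<open>t f - 1\<close>. It remains to remove \<open>t\<close>. For the degree reverse
  lexicographic order with
  \<open>n\<^sub>1\<^sub>3 < n\<^sub>1\<^sub>2 < n\<^sub>2\<^sub>3 < n\<^sub>1\<^sub>1 < n\<^sub>2\<^sub>2 < n\<^sub>3\<^sub>2 < m\<^sub>1\<^sub>1 < m\<^sub>2\<^sub>1 < m\<^sub>1\<^sub>3 < m\<^sub>3\<^sub>2 < m\<^sub>2\<^sub>2 < m\<^sub>1\<^sub>2 < m\<^sub>3\<^sub>1 < n\<^sub>2\<^sub>1 < n\<^sub>3\<^sub>1 < m\<^sub>2\<^sub>3\<close>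
  the ideal \<open>J\<close> has a Groebner basis of 3 quadrics and 36 cubics with integral coefficients, and
  none of its leading monomials involves \<open>n\<^sub>1\<^sub>2\<close> or \<open>n\<^sub>2\<^sub>3\<close>. They are therefore coprime to the leading
  monomial \<open>t n\<^sub>1\<^sub>2 n\<^sub>2\<^sub>3\<close> of \<open>t f - 1\<close>, so the Groebner basis stays one after adding \<open>t f - 1\<close>,
  and the normal form of \<open>p\<close> modulo \<open>J\<close> is zero.
\<close>

section \<open>Monomial rewriting\<close>

type_synonym 'v mon = "'v \<Rightarrow>\<^sub>0 nat"
type_synonym ('v, 'a) rule = "'v mon \<times> ('v mon \<times> 'a) list"

definition tail_poly :: "('v mon \<times> 'a) list \<Rightarrow> ('v, 'a::comm_ring_1) mpoly" where
  "tail_poly q = (\<Sum>(k, c)\<leftarrow>q. Poly_Mapping.single k c)"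

definition rule_poly :: "('v, 'a) rule \<Rightarrow> ('v, 'a::comm_ring_1) mpoly" where
  "rule_poly r = Poly_Mapping.single (fst r) 1 - tail_poly (snd r)"

lemma single_mult_sum_list:
  "Poly_Mapping.single m c * tail_poly q = tail_poly (map (\<lambda>(k, d). (m + k, c * d)) q)"
  by (induction q) (auto simp: tail_poly_def distrib_left mult_single)

text \<open>The leading terms cancel in an S-polynomial: \<open>L\<close> and \<open>L'\<close> are
  the leading monomials, \<open>A\<close> and \<open>B\<close> their cofactors, and \<open>W\<close>
  is a further common factor.\<close>

lemma mult_diff_cancel:
  fixes W :: "'r::comm_ring_1"
  assumes "A * L = B * L'"
  shows "(W * A) * (L - T) - (W * B) * (L' - T') = W * (B * T' - A * T)"
proof -
  have "(W * A) * (L - T) - (W * B) * (L' - T') = W * (A * L - B * L') + W * (B * T' - A * T)"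
    by (simp add: algebra_simps)
  then show ?thesis using assms by simp
qed

lemma telescope: "(a - b) + (b - c) = (a - c :: 'r::ab_group_add)"
  by simp

text \<open>A weight that is additive and drops along every rule takes the place of a monomial
  order: it makes rewriting terminate and carries the inductions below.\<close>

locale rewriting =
  fixes R :: "('v, 'a::comm_ring_1) rule set" and wt :: "'v mon \<Rightarrow> nat"
  assumes wt_add: "wt (m + m') = wt m + wt m'"
    and tail_lower: "(l, q) \<in> R \<Longrightarrow> (k, c) \<in> set q \<Longrightarrow> wt k < wt l"
begin

section \<open>Normal forms of monomials and of polynomials\<close>

definition reducible :: "'v mon \<Rightarrow> bool" where
  "reducible u \<longleftrightarrow> (\<exists>m. \<exists>r\<in>R. u = m + fst r)"

text \<open>One applicable rule is fixed for every reducible monomial, so that \<open>nf\<close> is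
  a function. That every other applicable rule leads to the same value is shown for joinable rules
  in \<open>lin_rule\<close>.\<close>

definition applied :: "'v mon \<Rightarrow> 'v mon \<times> ('v, 'a) rule" where
  "applied u = (SOME x. snd x \<in> R \<and> u = fst x + fst (snd x))"

lemma applied:
  assumes "reducible u"
  shows "snd (applied u) \<in> R" "u = fst (applied u) + fst (snd (applied u))"
proof -
  obtain m r where "r \<in> R" "u = m + fst r"
    using assms by (auto simp only: reducible_def)
  then have "\<exists>x. snd x \<in> R \<and> u = fst x + fst (snd x)"
    by (intro exI[of _ "(m, r)"]) simp
  from someI_ex[OF this] show "snd (applied u) \<in> R" "u = fst (applied u) + fst (snd (applied u))"
    by (simp_all add: applied_def)
qed

lemma tail_lower': "r \<in> R \<Longrightarrow> x \<in> set (snd r) \<Longrightarrow> wt (fst x) < wt (fst r)"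
  using tail_lower by (cases r; cases x) auto

function nf :: "'v mon \<Rightarrow> ('v, 'a) mpoly" where
  "nf u = (if reducible u
    then \<Sum>x\<leftarrow>snd (snd (applied u)). Poly_Mapping.single 0 (snd x) * nf (fst (applied u) + fst x)
    else Poly_Mapping.single u 1)"
  by auto
termination
proof (relation "measure wt")
  fix u x assume u: "reducible u" and x: "x \<in> set (snd (snd (applied u)))"
  have "wt (fst (applied u) + fst x) < wt (fst (applied u) + fst (snd (applied u)))"
    using tail_lower'[OF applied(1)[OF u] x] by (simp add: wt_add)
  then show "(fst (applied u) + fst x, u) \<in> measure wt"
    using applied(2)[OF u] by simp
qed simp

declare nf.simps [simp del]

definition lin :: "('v, 'a) mpoly \<Rightarrow> ('v, 'a) mpoly" where
  "lin p = (\<Sum>m\<in>Poly_Mapping.keys p. Poly_Mapping.single 0 (Poly_Mapping.lookup p m) * nf m)"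

lemma lin_superset:
  assumes "finite A" "Poly_Mapping.keys p \<subseteq> A"
  shows "lin p = (\<Sum>m\<in>A. Poly_Mapping.single 0 (Poly_Mapping.lookup p m) * nf m)"
  unfolding lin_def using assms by (intro sum.mono_neutral_left) (auto simp: in_keys_iff)

lemma lin_add: "lin (p + q) = lin p + lin q"
proof -
  let ?A = "Poly_Mapping.keys p \<union> Poly_Mapping.keys q"
  have "finite ?A" by simp
  then show ?thesis using keys_add[of p q]
    by (simp add: lin_superset[of ?A] lookup_add single_add distrib_right sum.distrib)
qed

lemma lin_0 [simp]: "lin 0 = 0"
  by (simp add: lin_def)

lemma lin_single: "lin (Poly_Mapping.single m c) = Poly_Mapping.single 0 c * nf m"
  by (cases "c = 0") (auto simp: lin_def)

lemma lin_diff: "lin (p - q) = lin p - lin q"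
  using lin_add[of "p - q" q] by (simp add: algebra_simps)

lemma lin_sum: "lin (\<Sum>i\<in>A. f i) = (\<Sum>i\<in>A. lin (f i))"
  by (induction A rule: infinite_finite_induct) (auto simp: lin_add)

lemma lin_tail_poly: "lin (tail_poly q) = (\<Sum>x\<leftarrow>q. Poly_Mapping.single 0 (snd x) * nf (fst x))"
  by (induction q) (auto simp: tail_poly_def lin_add lin_single)

lemma lin_const_mult: "lin (Poly_Mapping.single 0 c * p) = Poly_Mapping.single 0 c * lin p"
proof -
  have "Poly_Mapping.single 0 c * p =
      (\<Sum>m\<in>Poly_Mapping.keys p. Poly_Mapping.single m (c * Poly_Mapping.lookup p m))"
    by (subst mpoly_expansion[of p]) (simp add: sum_distrib_left mult_single)
  then have "lin (Poly_Mapping.single 0 c * p) =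
      (\<Sum>m\<in>Poly_Mapping.keys p. Poly_Mapping.single 0 (c * Poly_Mapping.lookup p m) * nf m)"
    by (simp only: lin_sum lin_single)
  also have "\<dots> = Poly_Mapping.single 0 c * lin p"
    by (simp add: lin_def sum_distrib_left mult_single flip: mult.assoc)
  finally show ?thesis .
qed

lemma lin_irreducible:
  assumes "\<And>u. u \<in> Poly_Mapping.keys p \<Longrightarrow> \<not> reducible u"
  shows "lin p = p"
proof -
  have "lin p = (\<Sum>m\<in>Poly_Mapping.keys p. Poly_Mapping.single m (Poly_Mapping.lookup p m))"
    unfolding lin_def using assms by (intro sum.cong) (auto simp: nf.simps mult_single)
  then show ?thesis using mpoly_expansion[of p] by simp
qed

section \<open>Combinations of rules of bounded weight, and Buchberger's criteria\<close>

inductive_set low :: "nat \<Rightarrow> ('v, 'a) mpoly set" for W where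
  zero: "0 \<in> low W"
| step: "p \<in> low W \<Longrightarrow> r \<in> R \<Longrightarrow> wt m + wt (fst r) < W \<Longrightarrow>
    p + Poly_Mapping.single m c * rule_poly r \<in> low W"

lemma low_add:
  assumes "p \<in> low W" "q \<in> low W"
  shows "p + q \<in> low W"
  using assms(2)
proof (induction q rule: low.induct)
  case (step q r m c)
  then show ?case using low.step[of "p + q" W r m c] by (simp add: add.assoc)
qed (simp add: assms(1))

lemma low_single: "r \<in> R \<Longrightarrow> wt m + wt (fst r) < W \<Longrightarrow> Poly_Mapping.single m c * rule_poly r \<in> low W"
  using low.step[OF low.zero] by fastforce

lemma low_shift:
  assumes "p \<in> low W" "W + wt w \<le> W'"
  shows "Poly_Mapping.single w d * p \<in> low W'"
  using assms(1)
proof (induction p rule: low.induct)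
  case zero then show ?case by (simp add: low.zero)
next
  case (step p r m c)
  have "Poly_Mapping.single (w + m) (d * c) * rule_poly r \<in> low W'"
    using step(2,3) assms(2) by (intro low_single) (auto simp: wt_add)
  then show ?case using low_add[OF step(4)]
    by (simp add: distrib_left mult_single flip: mult.assoc)
qed

lemma low_uminus: "p \<in> low W \<Longrightarrow> - p \<in> low W"
  \<comment> \<open>Additivity forces the monomial 1 to have weight 0, so that a constant factor
    keeps the bound.\<close>
  using low_shift[of p W 0 W "-1"] wt_add[of 0 0] by (simp add: single_uminus)

lemma low_diff: "p \<in> low W \<Longrightarrow> q \<in> low W \<Longrightarrow> p - q \<in> low W"
  using low_add[OF _ low_uminus] by fastforce

lemma low_tail_mult:
  assumes "r \<in> R" "\<And>x. x \<in> set q \<Longrightarrow> wt (fst x) + wt (fst r) < W"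
  shows "tail_poly q * rule_poly r \<in> low W"
  using assms(2)
proof (induction q)
  case (Cons x q)
  have "Poly_Mapping.single (fst x) (snd x) * rule_poly r \<in> low W"
    using Cons(2) by (intro low_single assms(1)) auto
  then show ?case using low_add Cons by (auto simp: tail_poly_def distrib_right split: prod.splits)
qed (simp add: tail_poly_def low.zero)

text \<open>The two ways of cancelling a common multiple of the leading monomials differ by a
  combination of rules whose leading terms stay strictly below its weight: the S-polynomial has a
  standard representation. All common multiples are considered, hence no least one has to be
  named.\<close>

definition joinable :: "('v, 'a) rule \<Rightarrow> ('v, 'a) rule \<Rightarrow> bool" where
  "joinable r s \<longleftrightarrow> (\<forall>m m'. m + fst r = m' + fst s \<longrightarrow>
    Poly_Mapping.single m 1 * rule_poly r - Poly_Mapping.single m' 1 * rule_poly s \<in> low (wt (m + fst r)))"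

lemma joinable_refl: "joinable r r"
  by (auto simp: joinable_def low.zero)

lemma joinable_sym: "joinable r s \<Longrightarrow> joinable s r"
  using low_uminus unfolding joinable_def by (metis minus_diff_eq)


text \<open>Coprimality of \<open>a\<close> and \<open>b\<close> makes \<open>a + l = b + l'\<close>
  the least common multiple, so every other common multiple arises from it by a factor
  \<open>w\<close>.\<close>

lemma cofactor:
  fixes m m' l l' a b :: "'v mon"
  assumes "m + l = m' + l'" "a + l = b + l'"
    "\<And>v. Poly_Mapping.lookup a v = 0 \<or> Poly_Mapping.lookup b v = 0"
  obtains w where "m = w + a" "m' = w + b"
proof
  have *: "Poly_Mapping.lookup m v = (Poly_Mapping.lookup m v - Poly_Mapping.lookup a v) + Poly_Mapping.lookup a v \<and>
      Poly_Mapping.lookup m' v = (Poly_Mapping.lookup m v - Poly_Mapping.lookup a v) + Poly_Mapping.lookup b v" for v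
    using arg_cong[OF assms(1), of "\<lambda>p. Poly_Mapping.lookup p v"]
      arg_cong[OF assms(2), of "\<lambda>p. Poly_Mapping.lookup p v"] assms(3)[of v]
    unfolding lookup_add by arith
  show "m = (m - a) + a" "m' = (m - a) + b"
    by (rule poly_mapping_eqI, unfold lookup_add lookup_minus, use * in blast)+
qed

text \<open>The least common multiple suffices: at any other common multiple the difference is
  multiplied by a monomial \<open>w\<close>, and the weight bound moves along by
  \<open>wt w\<close>.\<close>

lemma joinableI:
  assumes "a + fst r = b + fst s" "\<And>v. Poly_Mapping.lookup a v = 0 \<or> Poly_Mapping.lookup b v = 0"
    and S: "Poly_Mapping.single b 1 * tail_poly (snd s) - Poly_Mapping.single a 1 * tail_poly (snd r)
      \<in> low (wt (a + fst r))"
  shows "joinable r s"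
  unfolding joinable_def
proof (intro allI impI)
  fix m m' assume mm: "m + fst r = m' + fst s"
  obtain w where w: "m = w + a" "m' = w + b" using cofactor[OF mm assms(1,2)] .
  have eq: "Poly_Mapping.single m 1 * rule_poly r - Poly_Mapping.single m' 1 * rule_poly s =
      Poly_Mapping.single w 1 * (Poly_Mapping.single b 1 * tail_poly (snd s) - Poly_Mapping.single a 1 * tail_poly (snd r))"
  proof -
    have sp: "Poly_Mapping.single (w + x) (1::'a) = Poly_Mapping.single w 1 * Poly_Mapping.single x 1" for x
      by (simp add: mult_single)
    have "Poly_Mapping.single a (1::'a) * Poly_Mapping.single (fst r) 1 = Poly_Mapping.single b 1 * Poly_Mapping.single (fst s) 1"
      using assms(1) by (simp add: mult_single)
    from mult_diff_cancel[OF this] show ?thesis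
      unfolding rule_poly_def w sp .
  qed
  have "wt (a + fst r) + wt w \<le> wt (m + fst r)" by (simp add: w(1) wt_add)
  then show "Poly_Mapping.single m 1 * rule_poly r - Poly_Mapping.single m' 1 * rule_poly s \<in> low (wt (m + fst r))"
    unfolding eq by (rule low_shift[OF S])
qed

text \<open>Buchberger's first criterion. For coprime leading monomials the S-polynomial is the tail
  of \<open>s\<close> times \<open>r\<close> minus the tail of \<open>r\<close> times
  \<open>s\<close>, because the products of the two tails cancel. Both summands stay below the
  weight since tails are lighter than leading monomials.\<close>

lemma joinable_coprime:
  assumes "r \<in> R" "s \<in> R"
    "\<And>v. Poly_Mapping.lookup (fst r) v = 0 \<or> Poly_Mapping.lookup (fst s) v = 0"
  shows "joinable r s"
proof (rule joinableI[of "fst s" _ "fst r"])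
  have "Poly_Mapping.single (fst r) 1 * tail_poly (snd s) - Poly_Mapping.single (fst s) 1 * tail_poly (snd r)
      = tail_poly (snd s) * rule_poly r - tail_poly (snd r) * rule_poly s"
    unfolding rule_poly_def by (simp add: algebra_simps)
  also have "\<dots> \<in> low (wt (fst s + fst r))"
    using tail_lower'[OF assms(1)] tail_lower'[OF assms(2)]
    by (intro low_diff low_tail_mult assms) (auto simp: wt_add)
  finally show "Poly_Mapping.single (fst r) 1 * tail_poly (snd s) - Poly_Mapping.single (fst s) 1 * tail_poly (snd r)
      \<in> low (wt (fst s + fst r))" .
  show "fst s + fst r = fst r + fst s" by (rule add.commute)
  show "Poly_Mapping.lookup (fst s) v = 0 \<or> Poly_Mapping.lookup (fst r) v = 0" for v
    using assms(3)[of v] by (elim disjE) simp_all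
qed

text \<open>Buchberger's chain criterion. The leading monomial of \<open>s\<close> divides the least
  common multiple of those of \<open>r\<close> and \<open>t\<close>, so at every common multiple the
  difference telescopes through a multiple of \<open>s\<close>.\<close>

lemma joinable_via:
  assumes "joinable r s" "joinable s t"
    and "a + fst r = b + fst t" "\<And>v. Poly_Mapping.lookup a v = 0 \<or> Poly_Mapping.lookup b v = 0"
    and e: "a + fst r = e + fst s"
  shows "joinable r t"
  unfolding joinable_def
proof (intro allI impI)
  fix m m' assume mm: "m + fst r = m' + fst t"
  obtain w where w: "m = w + a" "m' = w + b" using cofactor[OF mm assms(3,4)] .
  have 1: "m + fst r = (w + e) + fst s" using e w by (simp add: add.assoc)
  have 2: "Poly_Mapping.single m 1 * rule_poly r - Poly_Mapping.single (w + e) 1 * rule_poly s \<in> low (wt (m + fst r))"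
    using assms(1) 1 unfolding joinable_def by blast
  have 3: "Poly_Mapping.single (w + e) 1 * rule_poly s - Poly_Mapping.single m' 1 * rule_poly t \<in> low (wt (m + fst r))"
    using assms(2) 1 mm unfolding joinable_def by metis
  show "Poly_Mapping.single m 1 * rule_poly r - Poly_Mapping.single m' 1 * rule_poly t \<in> low (wt (m + fst r))"
    using low_add[OF 2 3] unfolding telescope .
qed

text \<open>
  Buchberger's criterion. Two applicable rules give the same normal form because their difference is
  a combination of multiples of rules at strictly smaller weight, to which the induction applies.
\<close>

lemma lin_rule:
  assumes conf: "\<And>r s. r \<in> R \<Longrightarrow> s \<in> R \<Longrightarrow> joinable r s" and "r \<in> R"
  shows "lin (Poly_Mapping.single m c * rule_poly r) = 0"
  using assms(2)
proof (induction "wt (m + fst r)" arbitrary: m c r rule: less_induct)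
  case less
  have low0: "lin p = 0" if "p \<in> low (wt (m + fst r))" for p
    using that by (induction rule: low.induct) (auto simp: lin_add wt_add intro: less(1))
  let ?u = "m + fst r"
  have red: "reducible ?u" using less(2) by (auto simp: reducible_def)
  define m' s where "m' = fst (applied ?u)" and "s = snd (applied ?u)"
  have s: "s \<in> R" "?u = m' + fst s" using applied[OF red] by (auto simp: m'_def s_def)
  have "lin (Poly_Mapping.single m' 1 * rule_poly s) = nf ?u - lin (Poly_Mapping.single m' 1 * tail_poly (snd s))"
    by (simp add: rule_poly_def right_diff_distrib lin_diff mult_single lin_single s(2))
  also have "lin (Poly_Mapping.single m' 1 * tail_poly (snd s)) = nf ?u"
    using red by (subst nf.simps) (simp add: single_mult_sum_list lin_tail_poly o_def case_prod_unfold m'_def s_def)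
  finally have "lin (Poly_Mapping.single m' 1 * rule_poly s) = 0" by simp
  moreover have "lin (Poly_Mapping.single m 1 * rule_poly r - Poly_Mapping.single m' 1 * rule_poly s) = 0"
    using conf[OF less(2) s(1)] s(2) by (intro low0) (auto simp: joinable_def)
  ultimately have "lin (Poly_Mapping.single m 1 * rule_poly r) = 0" by (simp add: lin_diff)
  moreover have "Poly_Mapping.single m c * rule_poly r = Poly_Mapping.single 0 c * (Poly_Mapping.single m 1 * rule_poly r)"
    by (simp add: mult_single flip: mult.assoc)
  ultimately show ?case by (simp add: lin_const_mult)
qed

text \<open>By confluence \<open>lin\<close> vanishes on the ideal, while it fixes irreducible
  polynomials; an irreducible element of the ideal is therefore equal to its image 0.\<close>

lemma irreducible_in_ideal:
  assumes conf: "\<And>r s. r \<in> R \<Longrightarrow> s \<in> R \<Longrightarrow> joinable r s"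
    and p: "p \<in> genideal ring_of_type_algebra (rule_poly ` R)"
    and irr: "\<And>u. u \<in> Poly_Mapping.keys p \<Longrightarrow> \<not> reducible u"
  shows "p = 0"
proof -
  have rule0: "lin (a * rule_poly r) = 0" if "r \<in> R" for a r
  proof -
    have "a * rule_poly r = (\<Sum>m\<in>Poly_Mapping.keys a. Poly_Mapping.single m (Poly_Mapping.lookup a m) * rule_poly r)"
      by (subst mpoly_expansion[of a]) (simp add: sum_distrib_right)
    then show ?thesis by (simp add: lin_sum lin_rule[OF conf that])
  qed
  \<comment> \<open>The map \<open>lin\<close> is linear but not multiplicative; asking that it kill
    all multiples of \<open>p\<close> gives an ideal.\<close>
  have "ideal {p. \<forall>a. lin (a * p) = 0} ring_of_type_algebra"
    by (rule type_idealI) (auto simp: distrib_left lin_add simp flip: mult.assoc)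
  moreover have "rule_poly ` R \<subseteq> {p. \<forall>a. lin (a * p) = 0}"
    using rule0 by blast
  ultimately have "genideal ring_of_type_algebra (rule_poly ` R) \<subseteq> {p. \<forall>a. lin (a * p) = 0}"
    by (rule ring.genideal_minimal[OF ring_from_type_algebra])
  then have "\<forall>a. lin (a * p) = 0" using p by blast
  then have "lin p = 0" by (metis mult_1)
  then show ?thesis using lin_irreducible[OF irr] by simp
qed

text \<open>Termination alone yields a reduced representative. The property \<open>P\<close> of
  monomials is preserved by rewriting; it will say that \<open>t\<close> does not occur.\<close>

lemma irreducible_representative:
  fixes p :: "('v, 'a) mpoly"
  assumes P: "\<And>m r x. r \<in> R \<Longrightarrow> P (m + fst r) \<Longrightarrow> x \<in> set (snd r) \<Longrightarrow> P (m + fst x)"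
    and "\<And>u. u \<in> Poly_Mapping.keys p \<Longrightarrow> P u"
  obtains q where "p - q \<in> genideal ring_of_type_algebra (rule_poly ` R)"
    "\<And>u. u \<in> Poly_Mapping.keys q \<Longrightarrow> \<not> reducible u \<and> P u"
proof -
  let ?J = "genideal ring_of_type_algebra (rule_poly ` R)"
  note J = type_ideal_closed[OF ideal_genideal[of "rule_poly ` R"]]
  define good where "good p \<longleftrightarrow> (\<exists>q. p - q \<in> ?J \<and> (\<forall>u\<in>Poly_Mapping.keys q. \<not> reducible u \<and> P u))" for p
  have good0: "good 0" unfolding good_def using J(1) by (intro exI[of _ 0]) auto
  have good_add: "good (p + q)" if g: "good p" "good q" for p q
  proof -
    obtain p' q' where *: "p - p' \<in> ?J" "q - q' \<in> ?J" "\<forall>u\<in>Poly_Mapping.keys p'. \<not> reducible u \<and> P u"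
      "\<forall>u\<in>Poly_Mapping.keys q'. \<not> reducible u \<and> P u" using g by (auto simp: good_def)
    have "p + q - (p' + q') \<in> ?J" using J(2)[OF *(1,2)] by (simp add: algebra_simps)
    then show ?thesis using *(3,4) keys_add[of p' q'] by (auto simp: good_def)
  qed
  have good_const: "good (Poly_Mapping.single 0 c * p)" if g: "good p" for p c
  proof -
    obtain p' where *: "p - p' \<in> ?J" "\<forall>u\<in>Poly_Mapping.keys p'. \<not> reducible u \<and> P u" using g by (auto simp: good_def)
    have "Poly_Mapping.single 0 c * p - Poly_Mapping.single 0 c * p' \<in> ?J" using J(3)[OF *(1), of "Poly_Mapping.single 0 c"] by (simp add: right_diff_distrib)
    moreover have "Poly_Mapping.keys (Poly_Mapping.single 0 c * p') \<subseteq> Poly_Mapping.keys p'"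
      using keys_mult[of "Poly_Mapping.single 0 c" p'] by (auto split: if_splits)
    ultimately show ?thesis using * by (auto simp: good_def)
  qed
  \<comment> \<open>By induction on the weight: modulo the ideal a reducible monomial equals a
    shifted tail of a rule, whose monomials are lighter and still satisfy \<open>P\<close>.\<close>
  have good_mon: "good (Poly_Mapping.single u 1)" if "P u" for u
    using that
  proof (induction "wt u" arbitrary: u rule: less_induct)
    case less
    show ?case
    proof (cases "reducible u")
      case False
      then show ?thesis using less(2) J(1) unfolding good_def by (intro exI[of _ "Poly_Mapping.single u 1"]) auto
    next
      case True
      then obtain m r where r: "r \<in> R" "u = m + fst r" by (auto simp: reducible_def)
      have t: "good (Poly_Mapping.single m 1 * tail_poly q)" if "set q \<subseteq> set (snd r)" for q
        using that
      proof (induction q)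
        case (Cons x q)
        have "good (Poly_Mapping.single (m + fst x) 1)"
          using less(1)[of "m + fst x"] P[OF r(1), of m x] less(2) tail_lower'[OF r(1), of x] r(2) Cons(2)
          by (auto simp: wt_add)
        from good_add[OF good_const[OF this, of "snd x"] Cons(1)] Cons(2)
        show ?case by (cases x) (simp add: tail_poly_def distrib_left mult_single)
      qed (simp add: tail_poly_def good0)
      obtain q where q: "Poly_Mapping.single m 1 * tail_poly (snd r) - q \<in> ?J"
        "\<forall>u\<in>Poly_Mapping.keys q. \<not> reducible u \<and> P u"
        using t[of "snd r"] by (auto simp: good_def)
      have "Poly_Mapping.single m 1 * rule_poly r \<in> ?J"
        using ring.genideal_self[OF ring_from_type_algebra, of "rule_poly ` R"] r(1) by (auto intro!: J(3))
      from J(2)[OF this q(1)] have "Poly_Mapping.single u 1 - q \<in> ?J"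
        by (simp add: rule_poly_def right_diff_distrib mult_single r(2))
      then show ?thesis using q(2) by (auto simp: good_def)
    qed
  qed
  have "good (\<Sum>m\<in>A. Poly_Mapping.single m (f m))" if "\<And>m. m \<in> A \<Longrightarrow> P m" for A f
    using that
  proof (induction A rule: infinite_finite_induct)
    case (insert m A)
    have "good (Poly_Mapping.single 0 (f m) * Poly_Mapping.single m 1)" using insert by (intro good_const good_mon) auto
    from good_add[OF this insert(3)] insert show ?case by (simp add: mult_single)
  qed (auto simp: good0)
  then have "good p" using assms(2) mpoly_expansion[of p] by metis
  then show ?thesis using that by (auto simp: good_def)
qed

end

section \<open>Homogeneous ideals\<close>

lemma mon_degree_superset:
  assumes "finite A" "Poly_Mapping.keys m \<subseteq> A"
  shows "mon_degree m = (\<Sum>v\<in>A. Poly_Mapping.lookup m v)"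
  unfolding mon_degree_def using assms by (intro sum.mono_neutral_left) (auto simp: in_keys_iff)

lemma mon_degree_add: "mon_degree (m + m') = mon_degree m + mon_degree m'"
proof -
  let ?A = "Poly_Mapping.keys m \<union> Poly_Mapping.keys m'"
  have "finite ?A" by simp
  then show ?thesis using keys_add[of m m']
    by (simp add: mon_degree_superset[of ?A] lookup_add sum.distrib)
qed

lemma graded_piece_add: "p \<in> graded_piece d \<Longrightarrow> q \<in> graded_piece d \<Longrightarrow> p + q \<in> graded_piece d"
  using keys_add[of p q] by (auto simp: graded_piece_def)

lemma graded_piece_uminus: "p \<in> graded_piece d \<Longrightarrow> - p \<in> graded_piece d"
  by (simp add: graded_piece_def)

lemma graded_piece_diff: "p \<in> graded_piece d \<Longrightarrow> q \<in> graded_piece d \<Longrightarrow> p - q \<in> graded_piece d"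
  using graded_piece_add[of p d "- q"] graded_piece_uminus[of q d] by simp

lemma graded_piece_mult:
  assumes "p \<in> graded_piece d" "q \<in> graded_piece e"
  shows "p * q \<in> graded_piece (d + e)"
  unfolding graded_piece_def
proof (intro CollectI ballI)
  fix m assume "m \<in> Poly_Mapping.keys (p * q)"
  then obtain a b where "a \<in> Poly_Mapping.keys p" "b \<in> Poly_Mapping.keys q" "m = a + b"
    using keys_mult[of p q] by blast
  then show "mon_degree m = d + e"
    using assms by (simp add: graded_piece_def mon_degree_add)
qed

lemma Var_graded_piece: "Var v \<in> graded_piece 1"
  by (simp add: graded_piece_def Var_def mon_degree_def)

lemma lookup_homogeneous_component:
  "Poly_Mapping.lookup (homogeneous_component d p) m = (if mon_degree m = d then Poly_Mapping.lookup p m else 0)"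
  by (auto simp: homogeneous_component_def lookup_sum lookup_single when_def sum.delta in_keys_iff)

lemma homogeneous_component_add:
  "homogeneous_component d (p + q) = homogeneous_component d p + homogeneous_component d q"
  by (rule poly_mapping_eqI) (simp add: lookup_homogeneous_component lookup_add)

lemma homogeneous_component_0 [simp]: "homogeneous_component d 0 = 0"
  by (rule poly_mapping_eqI) (simp add: lookup_homogeneous_component)

lemma homogeneous_component_sum:
  "homogeneous_component d (\<Sum>i\<in>A. f i) = (\<Sum>i\<in>A. homogeneous_component d (f i))"
  by (induction A rule: infinite_finite_induct) (auto simp: homogeneous_component_add)

lemma homogeneous_component_single:
  "homogeneous_component d (Poly_Mapping.single m c) = (if mon_degree m = d then Poly_Mapping.single m c else 0)"
  by (rule poly_mapping_eqI) (auto simp: lookup_homogeneous_component lookup_single when_def)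

lemma homogeneous_component_graded:
  assumes "p \<in> graded_piece e"
  shows "homogeneous_component d p = (if d = e then p else 0)"
  by (rule poly_mapping_eqI) (use assms in \<open>auto simp: lookup_homogeneous_component graded_piece_def in_keys_iff\<close>)

lemma homogeneous_component_single_mult:
  "homogeneous_component d (Poly_Mapping.single m c * p) =
    (if mon_degree m \<le> d then Poly_Mapping.single m c * homogeneous_component (d - mon_degree m) p else 0)"
proof -
  have *: "homogeneous_component d (Poly_Mapping.single m c * Poly_Mapping.single k e) =
    (if mon_degree m \<le> d then Poly_Mapping.single m c * homogeneous_component (d - mon_degree m) (Poly_Mapping.single k e) else 0)"
    for k e
    by (auto simp: mult_single homogeneous_component_single mon_degree_add)
  have "homogeneous_component d (Poly_Mapping.single m c * (\<Sum>k\<in>A. Poly_Mapping.single k (f k))) =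
    (if mon_degree m \<le> d then Poly_Mapping.single m c * homogeneous_component (d - mon_degree m) (\<Sum>k\<in>A. Poly_Mapping.single k (f k)) else 0)"
    for A f
    by (simp only: sum_distrib_left homogeneous_component_sum *) simp
  then show ?thesis using mpoly_expansion[of p] by metis
qed

lemma homogeneous_ideal_genideal:
  assumes "\<And>x. x \<in> A \<Longrightarrow> \<exists>d. x \<in> graded_piece d"
  shows "homogeneous_ideal (genideal ring_of_type_algebra A)"
proof -
  let ?J = "genideal ring_of_type_algebra A"
  note J = type_ideal_closed[OF ideal_genideal[of A]]
  have sum: "(\<Sum>i\<in>B. f i) \<in> ?J" if "\<And>i. i \<in> B \<Longrightarrow> f i \<in> ?J" for B and f :: "('a \<Rightarrow>\<^sub>0 nat) \<Rightarrow> _"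
    using that by (induction B rule: infinite_finite_induct) (auto simp: J(1,2))
  \<comment> \<open>The polynomials all of whose components lie in \<open>?J\<close> form an ideal.
    It contains the generators, as each component of a homogeneous generator is that generator or
    0.\<close>
  have "ideal {p. \<forall>d. homogeneous_component d p \<in> ?J} ring_of_type_algebra"
  proof (rule type_idealI)
    fix a p assume p: "p \<in> {p. \<forall>d. homogeneous_component d p \<in> ?J}"
    have "homogeneous_component d (a * p) \<in> ?J" for d
    proof -
      have "a * p = (\<Sum>m\<in>Poly_Mapping.keys a. Poly_Mapping.single m (Poly_Mapping.lookup a m) * p)"
        by (subst mpoly_expansion[of a]) (simp add: sum_distrib_right)
      then have "homogeneous_component d (a * p) = (\<Sum>m\<in>Poly_Mapping.keys a.
          homogeneous_component d (Poly_Mapping.single m (Poly_Mapping.lookup a m) * p))"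
        by (simp only: homogeneous_component_sum)
      also have "\<dots> \<in> ?J"
        using p by (intro sum) (auto simp: homogeneous_component_single_mult J(1) intro: J(3))
      finally show ?thesis .
    qed
    then show "a * p \<in> {p. \<forall>d. homogeneous_component d p \<in> ?J}" by simp
  qed (auto simp: homogeneous_component_add J(1,2))
  moreover have "A \<subseteq> {p. \<forall>d. homogeneous_component d p \<in> ?J}"
  proof
    fix x assume x: "x \<in> A"
    then have "x \<in> ?J"
      using ring.genideal_self[OF ring_from_type_algebra, of A] by auto
    moreover obtain e where "x \<in> graded_piece e" using assms[OF x] by blast
    ultimately show "x \<in> {p. \<forall>d. homogeneous_component d p \<in> ?J}"
      by (simp add: homogeneous_component_graded J(1))
  qed
  ultimately have "?J \<subseteq> {p. \<forall>d. homogeneous_component d p \<in> ?J}"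
    by (rule ring.genideal_minimal[OF ring_from_type_algebra])
  then show ?thesis by (auto simp: homogeneous_ideal_def ideal_genideal)
qed

section \<open>Conjugates of strictly upper triangular matrices\<close>

lemma mult3_nth: "(A ** B) $ i $ j = A $ i $ 1 * B $ 1 $ j + A $ i $ 2 * B $ 2 $ j + A $ i $ 3 * B $ 3 $ j"
  for A B :: "'r::comm_ring_1^3^3"
  by (simp add: matrix_matrix_mult_def sum_3)

lemma trace3: "trace A = A $ 1 $ 1 + A $ 2 $ 2 + A $ 3 $ 3" for A :: "'r::comm_ring_1^3^3"
  by (simp add: trace_def sum_3)

lemma sl3_matrix_nth:
  "sl3_matrix x $ 1 $ 1 = x X11" "sl3_matrix x $ 1 $ 2 = x X12" "sl3_matrix x $ 1 $ 3 = x X13"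
  "sl3_matrix x $ 2 $ 1 = x X21" "sl3_matrix x $ 2 $ 2 = x X22" "sl3_matrix x $ 2 $ 3 = x X23"
  "sl3_matrix x $ 3 $ 1 = x X31" "sl3_matrix x $ 3 $ 2 = x X32" "sl3_matrix x $ 3 $ 3 = - x X11 - x X22"
  by (simp_all add: sl3_matrix_def)

lemma n_matrix_nth:
  "n_matrix x $ 1 $ 1 = 0" "n_matrix x $ 1 $ 2 = x N12" "n_matrix x $ 1 $ 3 = x N13"
  "n_matrix x $ 2 $ 1 = 0" "n_matrix x $ 2 $ 2 = 0" "n_matrix x $ 2 $ 3 = x N23"
  "n_matrix x $ 3 $ 1 = 0" "n_matrix x $ 3 $ 2 = 0" "n_matrix x $ 3 $ 3 = 0"
  by (simp_all add: n_matrix_def)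

text \<open>The factor \<open>det g\<close> appears because the adjugate replaces the inverse. In
  this form the identities hold for the generic matrix, before the relation \<open>det g = 1\<close>
  is imposed.\<close>

lemma conj_mult:
  fixes g :: "'r::comm_ring_1^3^3"
  shows "(g ** U ** adjugate g) ** (g ** V ** adjugate g) = g ** (U ** mat (det g) ** V) ** adjugate g"
  by (simp add: matrix_mul_assoc flip: adjugate_inverse(2))

lemma trace_conj:
  fixes g :: "'r::comm_ring_1^3^3"
  shows "trace (g ** U ** adjugate g) = trace (U ** mat (det g))"
proof -
  have "trace (g ** U ** adjugate g) = trace (g ** (U ** adjugate g))"
    by (simp add: matrix_mul_assoc)
  also have "\<dots> = trace ((U ** adjugate g) ** g)" by (rule trace_mul_sym)
  finally show ?thesis by (simp add: adjugate_inverse(2) flip: matrix_mul_assoc)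
qed

lemma trace_conj_n_matrix:
  fixes g :: "'r::comm_ring_1^3^3"
  shows "trace (g ** n_matrix u ** adjugate g) = 0"
  unfolding trace_conj by (simp add: mat_mult trace3 n_matrix_nth)

lemma trace_conj_n_matrix_mult:
  fixes g :: "'r::comm_ring_1^3^3"
  shows "trace ((g ** n_matrix u ** adjugate g) ** (g ** n_matrix v ** adjugate g)) = 0"
  unfolding conj_mult trace_conj by (simp add: mat_mult trace3 mult3_nth n_matrix_nth)

text \<open>The determinants are scalars, and apart from them the middle factor is a product of
  three strictly upper triangular 3 by 3 matrices.\<close>

lemma conj_n_matrix_mult3:
  fixes g :: "'r::comm_ring_1^3^3"
  shows "(g ** n_matrix u ** adjugate g) ** (g ** n_matrix v ** adjugate g) ** (g ** n_matrix w ** adjugate g) = 0"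
proof -
  have "n_matrix u ** mat (det g) ** n_matrix v ** mat (det g) ** n_matrix w = 0"
    by (simp add: matrix3_eq_iff mat_mult mult3_nth n_matrix_nth)
  moreover have "A ** 0 = 0" "0 ** A = 0" for A :: "'r^3^3"
    by (simp_all add: matrix3_eq_iff mult3_nth)
  ultimately show ?thesis unfolding conj_mult by simp
qed

lemma map_Ad:
  "map_matrix3 (subst Ad_coord) univ_M = gnn_g ** gnn_U ** (adjugate gnn_g :: 'a::comm_ring_1 gnn_poly^3^3)"
  "map_matrix3 (subst Ad_coord) univ_N = gnn_g ** gnn_V ** (adjugate gnn_g :: 'a gnn_poly^3^3)"
proof -
  \<comment> \<open>The entry in position (3,3) is not a coordinate; it is recovered from the
    vanishing of the trace.\<close>
  have 33: "A $ 3 $ 3 = - A $ 1 $ 1 - A $ 2 $ 2" if "trace A = 0" for A :: "'a gnn_poly^3^3"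
    using that by (simp add: trace3 algebra_simps eq_neg_iff_add_eq_0)
  note tr = trace_conj_n_matrix[of "gnn_g :: 'a gnn_poly^3^3"]
  show "map_matrix3 (subst Ad_coord) univ_M = gnn_g ** gnn_U ** (adjugate gnn_g :: 'a gnn_poly^3^3)"
    using 33[OF tr] unfolding gnn_U_def
    by (simp add: matrix3_eq_iff map_matrix3_def univ_M_def sl3_matrix_nth subst_diff subst_uminus gnn_U_def)
  show "map_matrix3 (subst Ad_coord) univ_N = gnn_g ** gnn_V ** (adjugate gnn_g :: 'a gnn_poly^3^3)"
    using 33[OF tr] unfolding gnn_V_def
    by (simp add: matrix3_eq_iff map_matrix3_def univ_N_def sl3_matrix_nth subst_diff subst_uminus gnn_V_def)
qed

lemma subst_trace: "subst \<sigma> (trace A) = trace (map_matrix3 (subst \<sigma>) A)"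
  for A :: "('v, 'a::comm_ring_1) mpoly^3^3"
  by (simp add: trace3 map_matrix3_def subst_add)

lemma subst_nth: "subst \<sigma> (A $ i $ j) = map_matrix3 (subst \<sigma>) A $ i $ j"
  by (simp add: map_matrix3_def)

section \<open>The open cell of the flag variety given by lower unipotent matrices\<close>

definition chart_g :: "'r::comm_ring_1 \<Rightarrow> 'r \<Rightarrow> 'r \<Rightarrow> 'r^3^3" where
  "chart_g a b c = vector [vector [1, 0, 0], vector [a, 1, 0], vector [c, b, 1]]"

text \<open>These are the entries above the diagonal of the conjugate of \<open>A\<close> by the
  inverse of \<open>chart_g a b c\<close>; they do not depend on \<open>c\<close>.\<close>

definition chart_n :: "'r::comm_ring_1 \<Rightarrow> 'r \<Rightarrow> 'r^3^3 \<Rightarrow> n_coord \<Rightarrow> 'r" where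
  "chart_n a b A = case_n_coord (A $ 1 $ 2 + A $ 1 $ 3 * b) (A $ 1 $ 3) (A $ 2 $ 3 - A $ 1 $ 3 * a)"

lemma chart_g_nth:
  "chart_g a b c $ 1 $ 1 = 1" "chart_g a b c $ 1 $ 2 = 0" "chart_g a b c $ 1 $ 3 = 0"
  "chart_g a b c $ 2 $ 1 = a" "chart_g a b c $ 2 $ 2 = 1" "chart_g a b c $ 2 $ 3 = 0"
  "chart_g a b c $ 3 $ 1 = c" "chart_g a b c $ 3 $ 2 = b" "chart_g a b c $ 3 $ 3 = 1"
  by (simp_all add: chart_g_def)

lemma det_chart_g: "det (chart_g a b c) = 1"
  by (simp add: det_3 chart_g_nth)

text \<open>The three entries above the diagonal come back unchanged. Several of the others are
  expressed by further entries of \<open>C\<close>, so that \<open>chart_entry\<close> can compare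
  them with those of \<open>A\<close> one after the other.\<close>

lemma chart_conj_nth:
  fixes a b c :: "'r::comm_ring_1" and A :: "'r^3^3"
  defines "C \<equiv> chart_g a b c ** n_matrix (chart_n a b A) ** adjugate (chart_g a b c)"
  shows "C $ 1 $ 1 = - a * A $ 1 $ 2 - c * A $ 1 $ 3" "C $ 1 $ 2 = A $ 1 $ 2" "C $ 1 $ 3 = A $ 1 $ 3"
    "C $ 2 $ 1 = - a * C $ 2 $ 2 - c * A $ 2 $ 3"
    "C $ 2 $ 2 = a * A $ 1 $ 2 - b * A $ 2 $ 3 + a * b * A $ 1 $ 3" "C $ 2 $ 3 = A $ 2 $ 3"
    "C $ 3 $ 1 = - (a * b - c) * C $ 1 $ 1 + b * C $ 2 $ 1"
    "C $ 3 $ 2 = - (a * b - c) * A $ 1 $ 2 + b * C $ 2 $ 2"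
  unfolding C_def
  by (simp_all add: mult3_nth adjugate_entries chart_g_nth n_matrix_nth chart_n_def algebra_simps)

text \<open>
  In the application \<open>(f, g, h)\<close> is the last column and \<open>(w\<^sub>1, w\<^sub>2, f)\<close> the first row of \<open>N\<^sup>2\<close>,
  which span the line and cut out the plane of the flag; \<open>t\<close> is the inverse of \<open>f\<close>.
\<close>

lemma chart_entry:
  fixes A :: "'r::comm_ring_1^3^3"
  assumes J: "ideal J ring_of_type_algebra"
    and tf: "t * f - 1 \<in> J"
    and A33: "A $ 3 $ 3 = - A $ 1 $ 1 - A $ 2 $ 2"
    and e1: "A $ 1 $ 1 * f + A $ 1 $ 2 * g + A $ 1 $ 3 * h \<in> J"
    and e2: "A $ 2 $ 1 * f + A $ 2 $ 2 * g + A $ 2 $ 3 * h \<in> J"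
    and r1: "w1 * A $ 1 $ 1 + w2 * A $ 2 $ 1 + f * A $ 3 $ 1 \<in> J"
    and r2: "w1 * A $ 1 $ 2 + w2 * A $ 2 $ 2 + f * A $ 3 $ 2 \<in> J"
    and r3: "w1 * A $ 1 $ 3 + w2 * A $ 2 $ 3 + f * A $ 3 $ 3 \<in> J"
    and wv: "w1 * f + w2 * g + f * h \<in> J"
  defines "\<gamma> \<equiv> chart_g (t * g) (- t * w2) (t * h)"
  shows "sl3_entry (\<gamma> ** n_matrix (chart_n (t * g) (- t * w2) A) ** adjugate \<gamma>) e - sl3_entry A e \<in> J"
proof -
  note c = type_ideal_closed[OF J]
  define a b c' d where "a = t * g" and "b = - t * w2" and "c' = t * h" and "d = t * w1"
  define C where "C = chart_g a b c' ** n_matrix (chart_n a b A) ** adjugate (chart_g a b c')"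
  note C = chart_conj_nth[of a b c' A, folded C_def]
  \<comment> \<open>Division by \<open>f\<close>: multiplication by \<open>t\<close> turns the
    coefficient \<open>f\<close> into 1, up to a multiple of \<open>t * f - 1\<close>.\<close>
  have invert: "x + y \<in> J" if "f * x + z \<in> J" "t * z = y" for x y z
  proof -
    have "x + y = t * (f * x + z) - x * (t * f - 1)"
      unfolding that(2)[symmetric] by (simp add: algebra_simps)
    then show ?thesis using c(6)[OF c(3)[OF that(1)] c(3)[OF tf]] by simp
  qed
  \<comment> \<open>Modulo \<open>J\<close>, \<open>p1\<close> and \<open>p2\<close> say that the
    first two rows of \<open>A\<close> kill the column (1, a, c'), and \<open>q1\<close> to
    \<open>q3\<close> that the row (d, -b, 1) kills the columns of \<open>A\<close>.\<close>
  have p1: "A $ 1 $ 1 + (a * A $ 1 $ 2 + c' * A $ 1 $ 3) \<in> J"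
    by (rule invert[of _ "A $ 1 $ 2 * g + A $ 1 $ 3 * h"]) (use e1 in \<open>simp_all add: a_def c'_def algebra_simps\<close>)
  have p2: "A $ 2 $ 1 + (a * A $ 2 $ 2 + c' * A $ 2 $ 3) \<in> J"
    by (rule invert[of _ "A $ 2 $ 2 * g + A $ 2 $ 3 * h"]) (use e2 in \<open>simp_all add: a_def c'_def algebra_simps\<close>)
  have q1: "A $ 3 $ 1 + (d * A $ 1 $ 1 - b * A $ 2 $ 1) \<in> J"
    by (rule invert[of _ "w1 * A $ 1 $ 1 + w2 * A $ 2 $ 1"]) (use r1 in \<open>simp_all add: b_def d_def algebra_simps\<close>)
  have q2: "A $ 3 $ 2 + (d * A $ 1 $ 2 - b * A $ 2 $ 2) \<in> J"
    by (rule invert[of _ "w1 * A $ 1 $ 2 + w2 * A $ 2 $ 2"]) (use r2 in \<open>simp_all add: b_def d_def algebra_simps\<close>)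
  have q3: "A $ 3 $ 3 + (d * A $ 1 $ 3 - b * A $ 2 $ 3) \<in> J"
    by (rule invert[of _ "w1 * A $ 1 $ 3 + w2 * A $ 2 $ 3"]) (use r3 in \<open>simp_all add: b_def d_def algebra_simps\<close>)
  \<comment> \<open>The row (d, -b, 1) kills the column (1, a, c'): the line of the flag lies in the
    plane.\<close>
  have s: "a * b - c' - d \<in> J"
  proof -
    have eq: "a * b - c' - d = (d + c') * (t * f - 1) - t * t * (w1 * f + w2 * g + f * h)"
      by (simp add: a_def b_def c'_def d_def algebra_simps)
    show ?thesis unfolding eq by (intro tf wv c(6) c(3))
  qed
  have 22: "C $ 2 $ 2 - A $ 2 $ 2 \<in> J"
  proof -
    \<comment> \<open>The vanishing of the trace enters here: the relations \<open>p1\<close> and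
      \<open>q3\<close> contribute the diagonal entries 1 and 3, whose sum is
      \<open>- A $ 2 $ 2\<close>.\<close>
    have eq: "C $ 2 $ 2 - A $ 2 $ 2 = (A $ 1 $ 1 + (a * A $ 1 $ 2 + c' * A $ 1 $ 3)) +
        (A $ 3 $ 3 + (d * A $ 1 $ 3 - b * A $ 2 $ 3)) + A $ 1 $ 3 * (a * b - c' - d)"
      by (simp add: C A33 algebra_simps)
    show ?thesis unfolding eq by (intro p1 q3 s c(2) c(6) c(5) c(3))
  qed
  have 11: "C $ 1 $ 1 - A $ 1 $ 1 \<in> J"
  proof -
    have eq: "C $ 1 $ 1 - A $ 1 $ 1 = - (A $ 1 $ 1 + (a * A $ 1 $ 2 + c' * A $ 1 $ 3))"
      by (simp add: C algebra_simps)
    show ?thesis unfolding eq by (intro p1 c(2) c(6) c(5) c(3))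
  qed
  have 21: "C $ 2 $ 1 - A $ 2 $ 1 \<in> J"
  proof -
    have eq: "C $ 2 $ 1 - A $ 2 $ 1 = - (A $ 2 $ 1 + (a * A $ 2 $ 2 + c' * A $ 2 $ 3)) - a * (C $ 2 $ 2 - A $ 2 $ 2)"
      unfolding C(4) by (simp add: algebra_simps)
    show ?thesis unfolding eq by (intro p2 22 c(2) c(6) c(5) c(3))
  qed
  have 31: "C $ 3 $ 1 - A $ 3 $ 1 \<in> J"
  proof -
    have eq: "C $ 3 $ 1 - A $ 3 $ 1 = (b * (C $ 2 $ 1 - A $ 2 $ 1) - (a * b - c') * (C $ 1 $ 1 - A $ 1 $ 1))
        - (A $ 1 $ 1 * (a * b - c' - d) + (A $ 3 $ 1 + (d * A $ 1 $ 1 - b * A $ 2 $ 1)))"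
      unfolding C(7) by (simp add: algebra_simps)
    show ?thesis unfolding eq by (intro 21 11 s q1 c(2) c(6) c(5) c(3))
  qed
  have 32: "C $ 3 $ 2 - A $ 3 $ 2 \<in> J"
  proof -
    have eq: "C $ 3 $ 2 - A $ 3 $ 2 = b * (C $ 2 $ 2 - A $ 2 $ 2)
        - (A $ 1 $ 2 * (a * b - c' - d) + (A $ 3 $ 2 + (d * A $ 1 $ 2 - b * A $ 2 $ 2)))"
      unfolding C(8) by (simp add: algebra_simps)
    show ?thesis unfolding eq by (intro 22 s q2 c(2) c(6) c(5) c(3))
  qed
  have "sl3_entry C e - sl3_entry A e \<in> J"
    using 11 21 22 31 32 c(1) by (cases e) (simp_all add: C(2,3,6))
  then show ?thesis by (simp only: C_def \<gamma>_def a_def b_def c'_def)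
qed

section \<open>The Groebner basis\<close>

text \<open>
  The variables of \<open>S\<close> are numbered 0 to 15 in increasing order, and 16 stands for \<open>t\<close>. A
  monomial is the ascending list of its variables, so that in a given degree the lexicographic order
  of lists is the reverse lexicographic order of monomials; polynomials are descending lists of
  terms. A pair \<open>(l, q)\<close> stands for the rule that replaces the monomial \<open>l\<close> by \<open>q\<close>. The
  \<open>weights\<close> of the variables make \<open>l\<close> heavier than all monomials of \<open>q\<close> in every rule.
\<close>

definition weights :: "nat list" where
  "weights = [0, 4, 12, 13, 15, 16, 2, 0, 17, 0, 9, 16, 0, 17, 15, 12, 0]"

definition base_rules :: "(int list \<times> (int list \<times> int) list) list" where
  "base_rules =
   [([4,4], [([3,4],-1), ([3,3],-1), ([2,5],-1), ([1,13],-1), ([0,14],-1)]),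
    ([10,10], [([9,15],-1), ([8,12],-1), ([7,11],-1), ([6,10],-1), ([6,6],-1)]),
    ([11,13], [([8,14],-1), ([5,15],-1), ([4,10],-2), ([4,6],-1), ([3,10],-1), ([3,6],-2),
      ([2,9],-1), ([1,7],-1), ([0,12],-1)]),
    ([3,3,3], [([1,4,13],-1), ([1,3,13],-2), ([1,2,14],-1), ([0,5,13],-1), ([0,4,14],1),
      ([0,3,14],-1)]),
    ([3,3,6], [([1,6,13],-1), ([1,4,7],-1), ([1,3,7],-1), ([1,2,12],-1), ([0,6,14],-1),
      ([0,5,7],-1), ([0,4,12],1)]),
    ([3,3,8], [([1,8,13],-1), ([1,4,15],-1), ([1,3,15],-1), ([1,2,10],1), ([1,2,6],1),
      ([0,8,14],-1), ([0,5,15],-1), ([0,4,10],-1), ([0,4,6],-1)]),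
    ([3,3,11], [([1,8,14],1), ([1,5,15],1), ([1,4,10],1), ([1,4,6],1), ([1,3,6],2), ([1,1,7],1),
      ([0,11,14],-1), ([0,5,10],-1), ([0,4,9],1), ([0,1,12],1)]),
    ([3,4,8], [([2,3,11],1), ([1,8,13],1), ([1,2,6],-1), ([0,8,14],1), ([0,5,15],1), ([0,4,10],2),
      ([0,4,6],2), ([0,3,10],1), ([0,3,6],2), ([0,2,9],1), ([0,1,7],1), ([0,0,12],1)]),
    ([3,4,10], [([3,4,6],-1), ([2,3,9],-1), ([1,10,13],1), ([1,6,13],1), ([1,2,12],1),
      ([0,9,13],1), ([0,4,12],-1)]),
    ([3,4,15], [([2,3,10],1), ([1,13,15],1), ([1,2,7],-1), ([0,10,13],-1), ([0,4,7],1)]),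
    ([3,5,8], [([3,4,11],-1), ([1,5,15],-1), ([1,4,10],-1), ([1,3,6],-1), ([1,1,7],-1),
      ([0,5,10],1), ([0,5,6],1), ([0,4,9],-1), ([0,1,12],-1)]),
    ([3,5,10], [([3,5,6],-1), ([3,4,9],1), ([3,3,9],1), ([1,10,14],1), ([1,6,14],1), ([1,4,12],-1),
      ([1,3,12],-1), ([0,9,14],1), ([0,5,12],-1)]),
    ([3,5,15], [([3,4,6],1), ([3,3,10],-1), ([2,3,9],1), ([1,14,15],1), ([1,10,13],-1),
      ([1,6,13],-1), ([1,4,7],1), ([1,3,7],1), ([1,2,12],-1), ([0,10,14],-1), ([0,9,13],-1),
      ([0,5,7],1), ([0,4,12],1)]),
    ([3,8,12], [([3,7,11],-1), ([3,6,6],-1), ([1,12,15],-1), ([1,7,10],-1), ([1,6,7],-1),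
      ([0,10,12],1), ([0,7,9],-1)]),
    ([3,10,11], [([3,8,9],-1), ([3,6,11],-1), ([1,8,12],1), ([1,6,10],1), ([1,6,6],1),
      ([0,11,12],-1), ([0,6,9],1)]),
    ([3,11,15], [([3,8,10],1), ([1,7,8],-1), ([1,6,15],1), ([0,7,11],1), ([0,6,10],-1)]),
    ([4,6,13], [([3,6,13],-1), ([3,4,7],1), ([3,3,7],1), ([2,6,14],-1), ([2,3,12],1),
      ([0,12,13],-1), ([0,7,14],1)]),
    ([4,7,8], [([4,6,15],1), ([3,7,8],-1), ([3,6,15],1), ([2,8,12],-1), ([2,6,10],-1),
      ([2,6,6],-1), ([0,12,15],1), ([0,7,10],1), ([0,6,7],1)]),
    ([4,7,11], [([4,6,10],1), ([3,7,11],-1), ([3,6,10],1), ([2,11,12],-1), ([2,6,9],1),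
      ([0,10,12],1), ([0,7,9],-1)]),
    ([4,8,13], [([3,8,13],-1), ([3,3,15],1), ([2,8,14],-1), ([2,3,6],-1), ([1,13,15],1),
      ([1,2,7],-1), ([0,14,15],1), ([0,6,13],1), ([0,4,7],1)]),
    ([4,8,14], [([4,5,15],-1), ([3,8,14],-1), ([3,4,6],-1), ([3,3,10],1), ([2,11,14],1),
      ([2,5,10],2), ([2,5,6],1), ([2,4,9],-1), ([2,3,9],-1), ([1,14,15],-1), ([1,10,13],1),
      ([1,6,13],1), ([1,4,7],-1), ([1,3,7],-1), ([0,10,14],2), ([0,6,14],2), ([0,4,12],-1),
      ([0,3,12],-1)]),
    ([4,11,15], [([4,8,10],1), ([2,10,11],1), ([2,8,9],1), ([2,6,11],1), ([1,7,8],1),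
      ([1,6,15],-1), ([0,8,12],1), ([0,6,10],1), ([0,6,6],1)]),
    ([5,6,13], [([4,6,14],1), ([3,5,7],1), ([3,4,12],-1), ([1,12,13],1), ([1,7,14],-1)]),
    ([5,7,8], [([5,6,15],1), ([4,8,12],1), ([4,6,10],1), ([4,6,6],1), ([1,12,15],-1),
      ([1,7,10],-1), ([1,6,7],-1)]),
    ([5,7,11], [([5,6,10],1), ([4,11,12],1), ([4,6,9],-1), ([1,10,12],-1), ([1,7,9],1)]),
    ([5,8,13], [([4,5,15],-1), ([3,8,14],-1), ([2,11,14],1), ([2,5,10],2), ([2,5,6],1),
      ([2,4,9],-1), ([2,3,9],-1), ([1,14,15],-1), ([0,10,14],1), ([0,6,14],2), ([0,5,7],1),
      ([0,4,12],-1), ([0,3,12],-1)]),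
    ([5,8,14], [([5,5,15],-1), ([4,11,14],-1), ([4,5,10],-2), ([4,5,6],-1), ([3,4,9],-1),
      ([3,3,9],-2), ([2,5,9],-1), ([1,10,14],-1), ([1,9,13],-1), ([1,6,14],-2), ([1,5,7],-1),
      ([1,4,12],2), ([1,3,12],2), ([0,9,14],-2), ([0,5,12],1)]),
    ([5,10,13], [([4,10,14],1), ([4,9,13],1), ([3,9,13],1), ([3,5,7],-1), ([3,4,12],1),
      ([3,3,12],1), ([2,9,14],1), ([1,7,14],1), ([0,12,14],1)]),
    ([5,11,15], [([5,8,10],1), ([4,10,11],-1), ([4,8,9],-1), ([4,6,11],-1), ([1,8,12],-1),
      ([1,7,11],-1), ([1,6,6],-1)]),
    ([5,13,15], [([4,14,15],1), ([4,10,13],-1), ([3,10,13],-1), ([3,3,7],-1), ([2,10,14],-1),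
      ([1,7,13],-1), ([0,7,14],-1)]),
    ([6,10,14], [([6,9,13],1), ([6,6,14],-1), ([5,7,10],-1), ([5,6,7],-1), ([4,10,12],1),
      ([4,7,9],1), ([4,6,12],1), ([3,10,12],1), ([3,6,12],2), ([2,9,12],1), ([1,7,12],1),
      ([0,12,12],1)]),
    ([6,14,15], [([6,10,13],-1), ([5,7,15],-1), ([4,12,15],1), ([4,7,10],-1), ([3,12,15],1),
      ([3,6,7],-1), ([2,10,12],-1), ([1,7,7],-1), ([0,7,12],-1)]),
    ([8,10,14], [([8,9,13],1), ([6,8,14],-1), ([5,10,15],-1), ([5,6,15],-1), ([4,9,15],2),
      ([4,8,12],1), ([3,9,15],1), ([3,7,11],-2), ([3,6,6],-2), ([2,11,12],-1), ([2,9,10],-1),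
      ([1,12,15],-1), ([1,7,10],-2), ([1,6,7],-2), ([0,10,12],2), ([0,7,9],-3), ([0,6,12],-1)]),
    ([8,12,13], [([7,8,14],1), ([6,6,13],-1), ([5,7,15],1), ([4,12,15],-1), ([4,7,10],1),
      ([3,7,10],1), ([3,6,7],2), ([2,10,12],1), ([1,7,7],1), ([0,7,12],1)]),
    ([8,12,14], [([7,11,14],-1), ([6,6,14],-1), ([5,12,15],-1), ([5,7,10],-1), ([5,6,7],-1),
      ([4,10,12],-1), ([4,7,9],1), ([3,10,12],-1), ([3,7,9],1)]),
    ([8,14,15], [([8,10,13],-1), ([5,15,15],-1), ([4,10,15],-2), ([4,6,15],-1), ([3,10,15],-1),
      ([3,7,8],-1), ([3,6,15],-1), ([2,9,15],-1), ([2,8,12],-1), ([2,7,11],-1), ([2,6,6],-1),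
      ([1,7,15],-1), ([0,7,10],1), ([0,6,7],1)]),
    ([10,11,14], [([8,9,14],-1), ([6,11,14],-1), ([5,8,12],1), ([5,6,10],1), ([5,6,6],1),
      ([4,11,12],1), ([4,6,9],-1), ([3,11,12],1), ([3,6,9],-1)]),
    ([11,12,15], [([8,10,12],1), ([7,10,11],-1), ([7,8,9],-1), ([6,8,12],-1), ([6,7,11],-2),
      ([6,6,6],-1)]),
    ([11,14,15], [([8,9,13],1), ([6,8,14],-1), ([5,10,15],-1), ([5,6,15],-1), ([4,9,15],2),
      ([4,6,10],-1), ([4,6,6],-1), ([3,9,15],1), ([3,7,11],-2), ([3,6,6],-2), ([2,9,10],-1),
      ([2,6,9],-1), ([1,7,10],-1), ([1,6,7],-1), ([0,10,12],1), ([0,7,9],-2), ([0,6,12],-1)])]"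

text \<open>The relation \<open>t f = 1\<close>. As \<open>N\<close> has trace 0, the upper right
  entry of its square is \<open>f = n12 n23 - n13 n22\<close>. The weights of the three monomials
  are 16, 15 and 0.\<close>

definition inverse_rule :: "int list \<times> (int list \<times> int) list" where
  "inverse_rule = ([1,2,16], [([0,4,16],1), ([],1)])"

section \<open>Arithmetic of coded monomials and polynomials\<close>

type_synonym coded = "(int list \<times> int) list"

definition mon :: "int list \<Rightarrow> int mon" where
  "mon l = (\<Sum>i\<leftarrow>l. Poly_Mapping.single i 1)"

definition decode :: "coded \<Rightarrow> (int mon \<times> 'a::comm_ring_1) list" where
  "decode = map (\<lambda>(k, c). (mon k, of_int c))"

definition decode_rule :: "int list \<times> coded \<Rightarrow> (int, 'a::comm_ring_1) rule" where
  "decode_rule r = (mon (fst r), decode (snd r))"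

lemma fst_decode_rule [simp]: "fst (decode_rule r) = mon (fst r)"
  by (simp add: decode_rule_def)

lemma snd_decode_rule [simp]: "snd (decode_rule r) = decode (snd r)"
  by (simp add: decode_rule_def)

text \<open>This comparison steers the merge in \<open>padd\<close>, so that equal monomials meet
  and cancel. By \<open>tail_poly_padd\<close> the sum is correct in whatever order the terms
  stand.\<close>

fun mless :: "int list \<Rightarrow> int list \<Rightarrow> bool" where
  "mless [] ys = (ys \<noteq> [])"
| "mless (x # xs) [] = False"
| "mless (x # xs) (y # ys) = (if x = y then mless xs ys else x < y)"

fun mmul :: "int list \<Rightarrow> int list \<Rightarrow> int list" where
  "mmul [] ys = ys"
| "mmul (x # xs) [] = x # xs"
| "mmul (x # xs) (y # ys) = (if x \<le> y then x # mmul xs (y # ys) else y # mmul (x # xs) ys)"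

fun mdiv :: "int list \<Rightarrow> int list \<Rightarrow> int list option" where
  "mdiv u [] = Some u"
| "mdiv [] (y # l) = None"
| "mdiv (x # u) (y # l) = (if x = y then mdiv u l else map_option (Cons x) (mdiv u (y # l)))"

fun mdiff :: "int list \<Rightarrow> int list \<Rightarrow> int list" where
  "mdiff u [] = u"
| "mdiff [] (y # l) = []"
| "mdiff (x # u) (y # l) =
    (if x = y then mdiff u l else if x < y then x # mdiff u (y # l) else mdiff (x # u) l)"

fun padd :: "coded \<Rightarrow> coded \<Rightarrow> coded" where
  "padd [] q = q"
| "padd (x # p) [] = x # p"
| "padd ((k, c) # p) ((l, d) # q) =
    (if k = l then (if c + d = 0 then padd p q else (k, c + d) # padd p q)
     else if mless l k then (k, c) # padd p ((l, d) # q)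
     else (l, d) # padd ((k, c) # p) q)"

fun pmul :: "int \<Rightarrow> int list \<Rightarrow> coded \<Rightarrow> coded" where
  "pmul c m [] = []"
| "pmul c m ((k, d) # q) = (mmul m k, c * d) # pmul c m q"

lemma mon_Nil [simp]: "mon [] = 0"
  by (simp add: mon_def)

lemma mon_Cons: "mon (x # l) = Poly_Mapping.single x 1 + mon l"
  by (simp add: mon_def)

lemma mon_mmul: "mon (mmul a b) = mon a + mon b"
  by (induction a b rule: mmul.induct) (simp_all add: mon_Cons ac_simps)

lemma mon_mdiv: "mdiv u l = Some m \<Longrightarrow> mon u = mon m + mon l"
  by (induction u l arbitrary: m rule: mdiv.induct) (auto simp: mon_Cons ac_simps split: if_splits)

lemma lookup_mon_eq_0: "x \<notin> set l \<Longrightarrow> Poly_Mapping.lookup (mon l) x = 0"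
  by (induction l) (auto simp: mon_Cons lookup_add lookup_single)

lemma disjoint_mon:
  assumes "list_all (\<lambda>x. x \<notin> set b) a"
  shows "Poly_Mapping.lookup (mon a) v = 0 \<or> Poly_Mapping.lookup (mon b) v = 0"
proof (cases "v \<in> set a")
  case True
  then have "v \<notin> set b" using assms by (auto simp: list_all_iff)
  from lookup_mon_eq_0[OF this] show ?thesis ..
next
  case False
  from lookup_mon_eq_0[OF this] show ?thesis ..
qed

lemma decode_simps [simp]:
  "decode [] = []" "decode (x # p) = (mon (fst x), of_int (snd x)) # decode p"
  by (auto simp: decode_def split: prod.splits)

lemma tail_poly_simps [simp]:
  "tail_poly [] = 0" "tail_poly (x # q) = Poly_Mapping.single (fst x) (snd x) + tail_poly q"
  by (auto simp: tail_poly_def split: prod.splits)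

lemma tail_poly_padd:
  "tail_poly (decode (padd p q)) = tail_poly (decode p) + (tail_poly (decode q) :: (int, 'a::comm_ring_1) mpoly)"
proof (induction p q rule: padd.induct)
  case (3 k c p l d q)
  let ?S = "\<lambda>k c. Poly_Mapping.single (mon k) (of_int c) :: (int, 'a) mpoly"
  have add: "?S k c + ?S k d = ?S k (c + d)" by (simp add: single_add)
  have rearrange: "(A + P) + (B + Q) = (A + B) + (P + Q)" for A B P Q :: "(int, 'a) mpoly"
    by (simp only: ac_simps)
  show ?case
  proof (cases "k = l")
    case True
    have "tail_poly (decode ((k, c) # p)) + tail_poly (decode ((l, d) # q)) =
        ?S k (c + d) + (tail_poly (decode p) + tail_poly (decode q))"
      unfolding True[symmetric] tail_poly_simps decode_simps fst_conv snd_conv add[symmetric]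
      by (rule rearrange)
    then show ?thesis using 3(1,2) True by (cases "c + d = 0") (simp_all del: of_int_add)
  next
    case False
    then show ?thesis using 3(3,4) by (cases "mless l k") (simp_all add: add.assoc add.left_commute)
  qed
qed simp_all

lemma tail_poly_pmul:
  "tail_poly (decode (pmul c m q)) = Poly_Mapping.single (mon m) (of_int c) * (tail_poly (decode q) :: (int, 'a::comm_ring_1) mpoly)"
  by (induction c m q rule: pmul.induct) (auto simp: distrib_left mult_single mon_mmul)

lemma list_all_padd:
  "list_all (\<lambda>x. P (fst x)) p \<Longrightarrow> list_all (\<lambda>x. P (fst x)) q \<Longrightarrow> list_all (\<lambda>x. P (fst x)) (padd p q)"
  by (induction p q rule: padd.induct) auto

lemma list_all_pmul: "list_all (\<lambda>x. P (fst x)) (pmul c m q) = list_all (\<lambda>x. P (mmul m (fst x))) q"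
  by (induction c m q rule: pmul.induct) auto

section \<open>The weight and the two rewriting systems\<close>

definition wt :: "int mon \<Rightarrow> nat" where
  "wt m = (\<Sum>i\<in>Poly_Mapping.keys m. Poly_Mapping.lookup m i * weights ! nat i)"

lemma wt_superset:
  assumes "finite A" "Poly_Mapping.keys m \<subseteq> A"
  shows "wt m = (\<Sum>i\<in>A. Poly_Mapping.lookup m i * weights ! nat i)"
  unfolding wt_def using assms by (intro sum.mono_neutral_left) (auto simp: in_keys_iff)

lemma wt_add: "wt (m + m') = wt m + wt m'"
proof -
  let ?A = "Poly_Mapping.keys m \<union> Poly_Mapping.keys m'"
  have "finite ?A" by simp
  then show ?thesis using keys_add[of m m']
    by (simp add: wt_superset[of ?A] lookup_add distrib_right sum.distrib)
qed

lemma wt_mon: "wt (mon l) = (\<Sum>i\<leftarrow>l. weights ! nat i)"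
proof (induction l)
  case (Cons i l)
  have "wt (Poly_Mapping.single i 1) = weights ! nat i" by (simp add: wt_def)
  then show ?case using Cons by (simp add: mon_Cons wt_add)
qed (simp add: wt_def)

lemma rule_weights:
  "list_all (\<lambda>(l, q). list_all (\<lambda>x. (\<Sum>i\<leftarrow>fst x. weights ! nat i) < (\<Sum>i\<leftarrow>l. weights ! nat i)) q)
    (inverse_rule # base_rules)"
  by (simp add: inverse_rule_def base_rules_def weights_def)

definition rules :: "(int list \<times> coded) set" where
  "rules = insert inverse_rule (set base_rules)"

lemma coded_tail_lower:
  assumes "r \<in> rules"
  shows "list_all (\<lambda>x. wt (mon (fst x)) < wt (mon (fst r))) (snd r)"
proof -
  have "\<forall>(l, q)\<in>rules. list_all (\<lambda>x. wt (mon (fst x)) < wt (mon l)) q"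
    using rule_weights by (simp add: rules_def wt_mon list_all_iff)
  then show ?thesis using assms by (cases r) auto
qed

lemma decoded_tail_lower:
  assumes "(l, q) \<in> decode_rule ` rules" "(k, c) \<in> set q"
  shows "wt k < wt l"
proof -
  obtain r where r: "r \<in> rules" "l = mon (fst r)" "q = decode (snd r)"
    using assms(1) by (auto simp: decode_rule_def)
  then obtain x where "x \<in> set (snd r)" "k = mon (fst x)"
    using assms(2) by (auto simp: decode_def)
  then show ?thesis using coded_tail_lower[OF r(1)] r(2) by (simp add: list_all_iff)
qed

text \<open>Two systems on the same polynomial ring: \<open>base\<close> rewrites by the 39 rules
  for \<open>J\<close> alone, \<open>grobner\<close> has the relation \<open>t f = 1\<close> in
  addition.\<close>

interpretation grobner: rewriting "decode_rule ` rules :: (int, 'a::comm_ring_1) rule set" wt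
  by unfold_locales (use wt_add decoded_tail_lower in blast)+

interpretation base: rewriting "decode_rule ` set base_rules :: (int, 'a::comm_ring_1) rule set" wt
  by unfold_locales (auto simp: wt_add intro!: decoded_tail_lower simp: rules_def)

text \<open>Index 39 is the relation for \<open>t\<close>. All indices out of range are sent there
  as well, so that \<open>rule_in_rules\<close> holds without bounds.\<close>

definition rule :: "int \<Rightarrow> int list \<times> coded" where
  "rule i = (if 0 \<le> i \<and> i < 39 then base_rules ! nat i else inverse_rule)"

lemma rule_in_rules: "rule i \<in> rules"
proof -
  have "length base_rules = 39" by (simp add: base_rules_def)
  then show ?thesis by (auto simp: rule_def rules_def)
qed

lemma rules_rule:
  assumes "r \<in> rules"
  obtains i where "0 \<le> i" "i < 40" "r = rule i"
proof (cases "r = inverse_rule")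
  case True
  then show ?thesis using that[of 39] by (simp add: rule_def)
next
  case False
  then obtain n where "n < length base_rules" "r = base_rules ! n"
    using assms by (auto simp: rules_def in_set_conv_nth)
  then show ?thesis using that[of "int n"] by (simp add: rule_def base_rules_def)
qed

section \<open>Certified reduction of S-polynomials\<close>

fun red :: "int list \<Rightarrow> coded \<Rightarrow> bool" where
  "red [] p = (p = [])"
| "red (i # is) [] = False"
| "red (i # is) ((u, c) # p) = (case rule i of (l, q) \<Rightarrow>
    (case mdiv u l of None \<Rightarrow> False | Some m \<Rightarrow> red is (padd p (pmul c m q))))"

text \<open>Each step subtracts the multiple of a rule whose leading term is the first term of the
  list. Reaching the empty list therefore exhibits the polynomial as a sum of multiples of rules,
  and all weights stay below \<open>W\<close> because tails are lighter.\<close>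

lemma red_low:
  assumes "red is p" "list_all (\<lambda>x. wt (mon (fst x)) < W) p"
  shows "(tail_poly (decode p) :: (int, 'a::comm_ring_1) mpoly) \<in> grobner.low W"
  using assms
proof (induction "is" p rule: red.induct)
  case (3 i "is" u c p)
  obtain l q where lq: "rule i = (l, q)" by (cases "rule i")
  then obtain m where m: "mdiv u l = Some m" and r: "red is (padd p (pmul c m q))"
    using 3(2) by (auto split: option.splits)
  have R: "(l, q) \<in> rules" using rule_in_rules[of i] lq by simp
  have u: "mon u = mon m + mon l" using mon_mdiv[OF m] .
  have uW: "wt (mon m) + wt (mon l) < W" using 3(3) by (simp add: u wt_add)
  have "list_all (\<lambda>x. wt (mon (fst x)) < W) (pmul c m q)"
    unfolding list_all_pmul[of "\<lambda>u. wt (mon u) < W"] mon_mmul wt_add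
    using coded_tail_lower[OF R] uW by (auto simp: list_all_iff)
  then have "list_all (\<lambda>x. wt (mon (fst x)) < W) (padd p (pmul c m q))"
    using 3(3) by (intro list_all_padd[of "\<lambda>u. wt (mon u) < W"]) auto
  from 3(1)[OF lq[symmetric] m r this]
  have "(tail_poly (decode (padd p (pmul c m q))) :: (int, 'a) mpoly) \<in> grobner.low W" .
  from grobner.low.step[OF this imageI[OF R], of "mon m" "of_int c"] uW
  have "tail_poly (decode (padd p (pmul c m q))) + Poly_Mapping.single (mon m) (of_int c) * rule_poly (decode_rule (l, q))
      \<in> (grobner.low W :: (int, 'a) mpoly set)"
    by simp
  moreover have "tail_poly (decode (padd p (pmul c m q))) + Poly_Mapping.single (mon m) (of_int c) * rule_poly (decode_rule (l, q))
      = (tail_poly (decode ((u, c) # p)) :: (int, 'a) mpoly)"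
    by (simp add: tail_poly_padd tail_poly_pmul rule_poly_def right_diff_distrib mult_single u)
  ultimately show ?case by simp
qed (simp_all add: grobner.low.zero)

text \<open>The output of \<open>mdiff\<close> is verified case by case: a common multiple with
  coprime cofactors is what the lemma \<open>cofactor\<close> asks for.\<close>

definition cofactors :: "int \<Rightarrow> int \<Rightarrow> (int list \<times> int list) option" where
  "cofactors i j = (let l = fst (rule i); l' = fst (rule j); a = mdiff l' l; b = mdiff l l' in
    if mmul a l = mmul b l' \<and> list_all (\<lambda>x. x \<notin> set b) a then Some (a, b) else None)"

definition spair_ok :: "int \<Rightarrow> int \<Rightarrow> int list \<Rightarrow> bool" where
  "spair_ok i j is = (case cofactors i j of None \<Rightarrow> False
    | Some (a, b) \<Rightarrow> red is (padd (pmul (-1) a (snd (rule i))) (pmul 1 b (snd (rule j)))))"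

definition coprime_ok :: "int \<Rightarrow> int \<Rightarrow> bool" where
  "coprime_ok i j = list_all (\<lambda>x. x \<notin> set (fst (rule j))) (fst (rule i))"

definition divides_lcm :: "int \<Rightarrow> int \<Rightarrow> int \<Rightarrow> bool" where
  "divides_lcm i j k = (case cofactors i j of None \<Rightarrow> False
    | Some (a, b) \<Rightarrow> mdiv (mmul a (fst (rule i))) (fst (rule k)) \<noteq> None)"

text \<open>The argument \<open>T\<close> carries the coefficient ring: the certificates have
  integral coefficients and serve for every commutative ring.\<close>

abbreviation joins :: "'a::comm_ring_1 itself \<Rightarrow> int \<Rightarrow> int \<Rightarrow> bool" where
  "joins T i j \<equiv> grobner.joinable (decode_rule (rule i) :: (int, 'a) rule) (decode_rule (rule j))"

lemma cofactors:
  assumes "cofactors i j = Some (a, b)"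
  shows "mon a + mon (fst (rule i)) = mon b + mon (fst (rule j))"
    "Poly_Mapping.lookup (mon a) v = 0 \<or> Poly_Mapping.lookup (mon b) v = 0"
proof -
  from assms have *: "mmul a (fst (rule i)) = mmul b (fst (rule j))" "list_all (\<lambda>x. x \<notin> set b) a"
    by (auto simp: cofactors_def Let_def split: if_splits)
  show "mon a + mon (fst (rule i)) = mon b + mon (fst (rule j))"
    using arg_cong[OF *(1), of mon] by (simp add: mon_mmul)
  show "Poly_Mapping.lookup (mon a) v = 0 \<or> Poly_Mapping.lookup (mon b) v = 0"
    using disjoint_mon[OF *(2)] .
qed

lemma joins_spair:
  assumes "spair_ok i j is"
  shows "joins TYPE('a::comm_ring_1) i j"
proof -
  obtain a b where ab: "cofactors i j = Some (a, b)"
    and r: "red is (padd (pmul (-1) a (snd (rule i))) (pmul 1 b (snd (rule j))))"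
    using assms by (auto simp: spair_ok_def split: option.splits)
  note c = cofactors[OF ab]
  define W where "W = wt (mon a + mon (fst (rule i)))"
  have Wi: "W = wt (mon a) + wt (mon (fst (rule i)))" and Wj: "W = wt (mon b) + wt (mon (fst (rule j)))"
    using c(1) by (simp_all add: W_def flip: wt_add)
  have w: "list_all (\<lambda>x. wt (mon (fst x)) < W) (padd (pmul (-1) a (snd (rule i))) (pmul 1 b (snd (rule j))))"
  proof (rule list_all_padd[of "\<lambda>u. wt (mon u) < W"])
    show "list_all (\<lambda>x. wt (mon (fst x)) < W) (pmul (-1) a (snd (rule i)))"
      unfolding list_all_pmul[of "\<lambda>u. wt (mon u) < W"] mon_mmul wt_add
      using coded_tail_lower[OF rule_in_rules[of i]] by (simp add: list_all_iff Wi)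
    show "list_all (\<lambda>x. wt (mon (fst x)) < W) (pmul 1 b (snd (rule j)))"
      unfolding list_all_pmul[of "\<lambda>u. wt (mon u) < W"] mon_mmul wt_add
      using coded_tail_lower[OF rule_in_rules[of j]] by (simp add: list_all_iff Wj)
  qed
  show ?thesis
  proof (rule grobner.joinableI)
    show "mon a + fst (decode_rule (rule i) :: (int, 'a) rule) = mon b + fst (decode_rule (rule j) :: (int, 'a) rule)"
      using c(1) by simp
    show "Poly_Mapping.lookup (mon a) v = 0 \<or> Poly_Mapping.lookup (mon b) v = 0" for v
      by (rule c(2))
    show "Poly_Mapping.single (mon b) 1 * tail_poly (snd (decode_rule (rule j))) -
        Poly_Mapping.single (mon a) 1 * tail_poly (snd (decode_rule (rule i)))
      \<in> (grobner.low (wt (mon a + fst (decode_rule (rule i) :: (int, 'a) rule))) :: (int, 'a) mpoly set)"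
      using red_low[OF r w, where 'a = 'a] by (simp add: W_def tail_poly_padd tail_poly_pmul single_uminus)
  qed
qed

lemma joins_coprime:
  assumes "coprime_ok i j"
  shows "joins TYPE('a::comm_ring_1) i j"
proof (rule grobner.joinable_coprime)
  show "Poly_Mapping.lookup (fst (decode_rule (rule i) :: (int, 'a) rule)) v = 0 \<or>
      Poly_Mapping.lookup (fst (decode_rule (rule j) :: (int, 'a) rule)) v = 0" for v
    using disjoint_mon[OF assms[unfolded coprime_ok_def], of v] by simp
qed (intro imageI rule_in_rules)+

lemma joins_via:
  assumes "joins TYPE('a::comm_ring_1) i k" "joins TYPE('a) k j" "divides_lcm i j k"
  shows "joins TYPE('a) i j"
proof -
  obtain a b m where ab: "cofactors i j = Some (a, b)"
    and m: "mdiv (mmul a (fst (rule i))) (fst (rule k)) = Some m"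
    using assms(3) by (auto simp: divides_lcm_def split: option.splits)
  show ?thesis
  proof (rule grobner.joinable_via[OF assms(1,2)])
    show "mon a + fst (decode_rule (rule i) :: (int, 'a) rule) = mon b + fst (decode_rule (rule j) :: (int, 'a) rule)"
      using cofactors(1)[OF ab] by simp
    show "Poly_Mapping.lookup (mon a) v = 0 \<or> Poly_Mapping.lookup (mon b) v = 0" for v
      by (rule cofactors(2)[OF ab])
    show "mon a + fst (decode_rule (rule i) :: (int, 'a) rule) = mon m + fst (decode_rule (rule k) :: (int, 'a) rule)"
      using mon_mdiv[OF m] by (simp add: mon_mmul)
  qed
qed

section \<open>Reduction of the S-polynomials\<close>

text \<open>
  An entry \<open>(j, is)\<close> of row \<open>i\<close> of \<open>cert_rows\<close> says that the S-polynomial of the rules \<open>i\<close> and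
  \<open>j\<close> becomes zero when the rules \<open>is\<close> are applied to the successive leading terms. An entry
  \<open>(j, k)\<close> of row \<open>i\<close> of \<open>via_rows\<close> says that the leading monomial of rule \<open>k\<close> divides the least common
  multiple of those of \<open>i\<close> and \<open>j\<close>, so that the pairs \<open>(i, k)\<close> and \<open>(k, j)\<close> take care of
  \<open>(i, j)\<close>. All other pairs have coprime leading monomials.
\<close>

definition cert_rows :: "(int \<times> int list) list list" where
  "cert_rows =
   [[],
    [],
    [],
    [],
    [(3,[16,22])],
    [(3,[19,9,25,20,12,8]), (4,[17,23])],
    [(2,[5,12,8,3,29,16,2,27,22]), (3,[2,20,0,0,2,12,8,4,2,26,11]), (4,[2,18,24]),
     (5,[2,21,15,28])],
    [(0,[5,3,10,19,0,25,20,0,0,4]), (5,[6,19,0,20,0,0,12,8,4])],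
    [(0,[0,8,3,3,11,27,22,0]), (1,[9,7,18,8,6,4,1,2,34,30]),
     (3,[3,3,0,0,8,27,22,27,16,0,0,22,8,0,4,3]), (4,[4,4,16,16,0,0,8,30,30,16,0,8]),
     (7,[7,14,32,1,18,1,13])],
    [(0,[9,3,12,8,29,0]), (3,[3,0,9,29,29,0,9]), (4,[4,16,0,9,31,31,16,0,9]), (7,[15,35,17]),
     (8,[9,1,13,1,33,2])],
    [(5,[6,25,20,0,0,26,0,11]), (7,[0,6,3,25,2,20,0,0,2,12,8,2])],
    [(1,[12,10,24,11,8,4,1,34,30]), (3,[3,3,3,27,16,0,11,22,8,0,4,3,27,22,0,11]),
     (4,[4,4,3,22,22,30,16,0,0,30,11,30,0,11]), (8,[0,3,27,22,0]),
     (10,[10,8,7,5,2,2,1,18,1,2,1,24])],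
    [(3,[3,3,3,29,0,0,0,12,9,8,3,27,22,29,27,16,0,0,0,12,22,0,4,3]),
     (4,[4,3,4,22,31,16,0,0,0,31,12,30,31,30,16,0,0,12]), (9,[0,8,3,11,29,0,27,22,0]),
     (10,[9,7,5,14,2,17,1,2,32,23,1,18,1,13]), (11,[12,9,8,1,5,6,4,1,2,1])],
    [(5,[6,4,33,34]), (7,[18,8,6,4,33,34,30]), (10,[24,11,4,30])],
    [(1,[15,13,37,1]), (2,[32,2,1,7,18,8,1,5,6,4,33,2,34]), (6,[5,4,32,2,1,18,13,36,1]),
     (8,[7,2,32,2,1,18,1,13,2]), (11,[10,6,36]), (13,[13,14,13,14,37,1,37,1,37])],
    [(2,[35,5,4,13,2,31]), (6,[5,35,1,38,32,1,18]), (9,[7,2,35,17,2]), (12,[10,8,6,38,32,23,18]),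
     (13,[13,15,15,37,1,37,1]), (14,[1,13,15,37,1])],
    [(0,[0,4,3,22]), (2,[20,0,0,2,12,18,8,4,2,34,30]), (4,[3,3,3,4,3,16,22,16,0,0]),
     (8,[16,4,4,8,3,3,30,11,8,4,30,27,22,16]), (9,[4,9,3,31,12,9,8,4,31,29,16])],
    [(0,[0,5,4,23]), (7,[9,5,4,13,31])],
    [(0,[0,6,4,24,2]), (2,[17,31,0,0,0,2,31,9,8,2,30]),
     (6,[4,3,3,6,4,2,17,31,0,0,0,2,31,9,8,34,30,2,23,31,20,30,16,0,0,13,30,12,8,4]),
     (8,[1,9,7,8,6,1,4,4,4,4,4,14,13,2,1,1,36,2,31,30,1,23,18,1,13]), (17,[21,15,37])],
    [(0,[5,9,25,20,29,0]), (2,[20,0,0,2,10,9,7,7,6,4,17,2,2,23]), (7,[5,3,2,12,8,4,29,16]),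
     (16,[7,5,4,13,33]), (17,[16,9,33,31])],
    [(0,[0,9,0,5,12,8,4,3,3,26,0,11,29,16,0,22]), (7,[9,5,4,3,11,29,16,0,0]),
     (9,[9,5,4,3,15,11,29,16,0,35,17,0]), (17,[31,16,0,0,31,12,9,8,4,34]),
     (19,[29,0,0,9,16,4,3,2,27,22])],
    [(0,[0,9,7,6,5,28,2,35,17,1,2,1]), (2,[20,19,0,0,35,12,8,9,5,38,2,32,2,1,18,1,13,33,31]),
     (9,[7,14,2,35,2,18,13]), (15,[14,17,18,13]), (18,[17,15,37,1,1]),
     (20,[20,21,15,9,7,6,1,5,5,5,4,4,38,32,2,28,28,1,21,18,15,14,38,2,32,1,23,1,18,17,1,37,36,1,31,1,24,23,23,18,1,18,15,13,1,13,1])],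
    [(2,[26,24,11,2,34,30]), (4,[4,3,3,22,0,0,22]), (16,[0,22,0,4,3])],
    [(10,[12,7,18,8,6,33,31,34,30]), (17,[0,0,0,10,12,7,18,8,5,6,4,4,33,31,34,30])],
    [(2,[23,31,2,30,0,0,12,11,8]), (6,[4,6,4,23,31,30,12,11,8,24]),
     (11,[1,12,10,11,8,18,8,4,2,32,33,36,2,31,30,23,1,18,1,13,2,34,30,24]), (18,[0,0,24,6,4,2]),
     (23,[28,37])],
    [(2,[26,20,10,10,8,7,6,5,2,2,1,18,1,2,1,24]), (10,[2,7,9,0,0,5,8,4,3,3,11,29,16,0,27,22,0]),
     (19,[0,10,2,9,0,0,8,4,3,3,26,0,29,16,0,27,22,0]), (22,[20,10,7,18,8,6,34,30]),
     (23,[22,19,31,16,0,0,13,2,9,8,4,34])],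
    [(10,[12,8,11,4,3,27]), (12,[12,9,7,8,5,11,4,3,14,2,27,17,1,2,32,23,1,18,1,13]),
     (20,[0,0,0,10,8,0,6,11,3,2,27,22,0]), (23,[31,22,20,18,30,16,0,0,0,13,30,12,11,8,4]),
     (25,[29,2,20,27,16,0,0,0,11,0,4,3])],
    [(1,[29,25,2,23,31,22,22,1,20,18,30,16,0,0,0,13,30,12,11,8,4]),
     (2,[26,2,20,0,0,2,1,12,10,24,11,8,6,4,1,34,30]), (11,[22,8,3]), (22,[16,11,8,4]),
     (25,[20,19,10,7,18,1,6,4,1,2,1,34,30])],
    [(2,[26,25,21,2,19,2,20,0,0,0,32,11,12,1,18,8,1,5,6,4,1,33,2,31,1,34]),
     (12,[10,8,7,6,38,2,32,2,1,18,1,13,2,24]), (15,[8,7,2,32,2,23,1,18,1,13,2,24]),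
     (21,[0,0,0,8,7,6,5,4,2,32,2,23,1,18,1,13,2,1]), (24,[23,21,18,17,18,14,1,13,1,1]),
     (26,[26,28,21,20,20,20,21,21,14,9,7,8,7,1,6,5,5,6,4,28,14,36,1,2,1,34,2,21,17,15,1,1,38,2,34,32,30,28,24,1,24,1,18,14,13,1])],
    [(2,[26,2,20,0,0,2,11,1,7,18,8,1,34,30]), (12,[9,8,3]), (22,[16,12,9,8,4]), (25,[20,19,9,5]),
     (26,[29,2,19,27,16,0,0,0,11,9,0,5,4,3]), (27,[1,19,2,17,31,16,16,0,0,0,1,2,31,12,9,8,4,1,34])],
    [(1,[31,34,1,23,24,1,1,13]), (4,[4,4,11,8,3,3,3,30,27,22,16,30,27,22]),
     (8,[16,8,0,0,0,4,4,3,3,11,30,16,0,27,22,0]), (11,[22,11,8,4,11,4,3,30,27]),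
     (16,[16,16,27,16,0,0,0,30,11,22,8,16,0,4,3,30,27,22]),
     (27,[22,22,27,22,30,16,27,16,0,0,0,11,8,0,3])],
    [(4,[4,12,9,8,3,3,3,31,29,16,31,29,22]),
     (9,[8,16,9,0,0,4,8,4,3,3,3,30,12,11,8,4,31,16,0,30,29,27,22,16,0]),
     (12,[11,22,12,16,9,8,4,12,11,4,3,31,29,22,16,22]), (16,[16,29,0,0,31,12,9,8,16,3,31,29]),
     (22,[22,29,31,29,0,0,12,12,22,8,8]), (30,[1,33,2,31,1,17,18,13,1])],
    [(1,[35,34,1,24,23,23,21,17,1,18,13,14,1,1]),
     (5,[5,4,11,9,5,3,3,6,32,27,22,2,17,31,16,16,0,0,0,2,31,9,2,1,34,30,32,29,2,23,31,22,22,1,20,18,30,16,0,0,0,13,30,12,11,8,4]),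
     (8,[7,8,0,0,9,5,6,4,3,3,2,12,10,8,4,32,19,17,31,16,16,0,2,31,9,8,2,29,25,20,18,30,16,0,0,13,30,11,8,4]),
     (11,[10,11,2,9,7,0,0,5,6,4,8,4,3,3,11,32,29,25,23,31,22,22,20,16,0,13,12,8,27,26,24,30,22,0,11]),
     (20,[19,20,0,0,32,11,18,8,1,6,4,4,36,1,24,1,2,1,34]),
     (25,[25,22,27,22,20,19,32,11,10,2,10,22,12,2,9,7,18,8,9,8,0,0,6,4,4,4,8,3,3,36,2,2,1,27,26,24,22,11,29,22,16,1,34,30,22]),
     (26,[25,26,36,20,1,18,0,0,12,11,8,6,4,2,1,34]), (30,[23,23,17,1,18,13,14,13,1])],
    [(2,[34,2,24,23,23,18,17,1,13,1,1]), (13,[2,9,8]), (19,[17,31,16,16,13,2,31,9,8]),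
     (25,[23,31,22,22,20,12,8])],
    [(13,[12,11,8]), (20,[18,30,16,0,0,13,30,11,8,4]), (26,[24,30,22,11]),
     (32,[33,36,34,30,1,24,1,18,1,13]), (33,[2,29,27,22])],
    [(5,[5,12,8,3,3,5,6,4,35,29,17,16,1,31,35,27,23,22,1,2,31,0,0,0]),
     (20,[19,0,0,35,12,8,7,5,38,32,18,13,31]), (26,[25,21,20,11,10,18,1,5,6,4,36,24,1,2,1,34]),
     (31,[23,17,13,15,1,1]), (32,[1,33,2,31,23,1,18,17,17,1,13,15,37,1,1]),
     (34,[33,38,32,31,1,18,1,1])],
    [(1,[38,34,32,28,24,24,18,1]), (2,[32,2,25,22,22,2,1,20,18,16,0,0,2,1,13,12,11,8,4]),
     (14,[10,11,6]), (18,[17,1,20,30,16,17,0,0,0,14,1,30,10,12,11,18,8,6,4,4,36,24,2,1,34]),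
     (24,[23,1,26,30,22,23,36,18,0,0,11,6,4,2,1,34]), (30,[2,24,1,18,14,13,1]),
     (32,[2,28,1,23,1,21,18,15,13,14,37])],
    [(2,[34,33,38,2,32,33,2,31,1,17,18,1,13,1]), (15,[14,13]), (21,[18,17,1,18,14,1,13,1]),
     (28,[24,23,1,24,1])],
    [(2,[35,32,19,16,16,13,2,31,9,2,34,30]), (15,[32,7,8,33,31,34,30]),
     (21,[20,19,20,0,0,0,32,11,7,18,1,5,6,4,36,1,24,1,33,2,31,1,34,30]),
     (28,[26,25,26,36,20,1,18,0,0,12,11,8,6,4,2,1]), (31,[2,30,24,23,23,18,17,15,13,14,13,1,1]),
     (34,[33,38,2,34,31,2,30,28,24,18,17,21,18,17,18,14,15,13,13,1,13,37,1,37,1,37,1]),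
     (35,[2,32,28,21,1,17,21,14,1,13,15,1,1]), (36,[35,31,2,1,18,14,1,1]), (37,[32,36,34,23,18])]]"

definition via_rows :: "(int \<times> int) list list" where
  "via_rows =
   [[],
    [],
    [],
    [],
    [],
    [],
    [],
    [(3,5), (4,5), (6,5)],
    [(5,7), (6,14)],
    [(5,7), (6,15)],
    [(3,5), (4,5), (6,5), (8,7), (9,7)],
    [(5,10), (6,14), (7,8), (9,8)],
    [(5,10), (6,15), (7,9), (8,9)],
    [(3,5), (4,5), (6,5), (8,7), (9,7), (11,10), (12,10)],
    [(3,6), (4,6), (5,6), (7,8), (9,8), (10,11), (12,11)],
    [(3,6), (4,6), (5,6), (7,9), (8,9), (10,12), (11,12)],
    [(7,19)],
    [(5,7), (8,7), (9,7), (10,7), (13,7), (16,19)],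
    [(7,17), (9,21), (14,8), (15,21), (16,2)],
    [(5,7), (8,7), (9,7), (10,7), (13,7), (18,2)],
    [(5,7), (8,7), (10,7), (13,7), (16,19), (18,17)],
    [(6,15), (7,9), (8,9), (12,9), (14,15), (16,2), (17,18), (19,2)],
    [(10,25), (11,27), (12,29), (19,16)],
    [(5,10), (7,10), (11,10), (12,10), (13,10), (18,17), (19,17), (20,17), (22,25)],
    [(10,23), (12,28), (14,11), (15,28), (17,18), (21,18), (22,2)],
    [(5,10), (7,10), (11,10), (12,10), (13,10), (16,19), (17,19), (20,19), (24,2)],
    [(5,10), (7,10), (11,10), (13,10), (17,20), (19,20), (22,25), (24,23)],
    [(8,11), (10,11), (12,11), (14,2), (16,22), (19,25), (23,25), (24,2), (26,25)],
    [(6,15), (9,12), (10,12), (11,12), (14,15), (18,21), (22,2), (23,24), (25,2), (27,2)],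
    [(9,12), (10,12), (11,12), (15,2), (16,22), (19,25), (21,2), (23,25), (24,2), (28,2)],
    [(14,36), (20,32), (22,27), (26,32)],
    [(15,38), (20,35), (21,38), (26,35), (28,38), (29,22)],
    [(7,8), (10,11), (13,34), (14,36), (17,20), (19,20), (23,26), (27,25), (31,30)],
    [(5,13), (7,13), (10,13), (16,19), (17,19), (20,19), (22,25), (23,25), (26,25), (27,25),
     (29,25), (32,34)],
    [(5,13), (7,13), (10,13), (17,20), (19,20), (23,26), (25,26), (30,32), (31,35)],
    [(7,20), (9,20), (10,26), (12,26), (13,34), (15,38), (17,20), (19,20), (21,20), (23,26),
     (25,26), (28,26), (29,26), (30,31), (33,34)],
    [(6,14), (8,14), (11,14), (15,14), (20,32), (21,38), (26,32), (27,2), (28,38), (31,30), (34,32),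
     (35,32)],
    [(6,15), (9,15), (12,15), (13,15), (14,15), (18,21), (24,28), (29,2), (31,38), (33,2), (34,38),
     (35,38), (36,38)],
    [(6,15), (9,15), (12,15), (14,15), (18,21), (20,21), (24,28), (26,28), (29,2), (30,31),
     (32,35)]]"

section \<open>Evaluation of the tables: all pairs of rules are joinable\<close>

definition indices :: "int list" where
  "indices = [0, 1, 2, 3, 4, 5, 6, 7, 8, 9, 10, 11, 12, 13, 14, 15, 16, 17, 18, 19, 20, 21, 22,
    23, 24, 25, 26, 27, 28, 29, 30, 31, 32, 33, 34, 35, 36, 37, 38]"

definition cert_row :: "int \<Rightarrow> (int \<times> int list) list" where
  "cert_row i = cert_rows ! nat i"

definition cert_partners :: "int \<Rightarrow> int list" where
  "cert_partners i = map fst (cert_row i)"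

definition via_row :: "int \<Rightarrow> (int \<times> int) list" where
  "via_row i = via_rows ! nat i"

definition spairs_ok :: "int \<Rightarrow> bool" where
  "spairs_ok i = list_all (\<lambda>(j, is). spair_ok i j is) (cert_row i)"

definition adjacent :: "int \<Rightarrow> int \<Rightarrow> bool" where
  "adjacent i j \<longleftrightarrow> coprime_ok i j \<or> j \<in> set (cert_partners i) \<or> i \<in> set (cert_partners j)"

text \<open>Both pairs through \<open>k\<close> must be adjacent, that is, settled without another
  intermediate rule; one application of the chain criterion is then enough.\<close>

definition vias_ok :: "int \<Rightarrow> bool" where
  "vias_ok i = list_all (\<lambda>(j, k). 0 \<le> k \<and> k < 39 \<and> adjacent i k \<and> adjacent k j \<and> divides_lcm i j k) (via_row i)"

definition covered :: "int \<Rightarrow> bool" where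
  "covered i = list_all (\<lambda>j. j < i \<longrightarrow> adjacent i j \<or> j \<in> set (map fst (via_row i))) indices"

lemmas rule_simps =
  rule_def[of 0, unfolded base_rules_def inverse_rule_def, simplified]
  rule_def[of 1, unfolded base_rules_def inverse_rule_def, simplified]
  rule_def[of 2, unfolded base_rules_def inverse_rule_def, simplified]
  rule_def[of 3, unfolded base_rules_def inverse_rule_def, simplified]
  rule_def[of 4, unfolded base_rules_def inverse_rule_def, simplified]
  rule_def[of 5, unfolded base_rules_def inverse_rule_def, simplified]
  rule_def[of 6, unfolded base_rules_def inverse_rule_def, simplified]
  rule_def[of 7, unfolded base_rules_def inverse_rule_def, simplified]
  rule_def[of 8, unfolded base_rules_def inverse_rule_def, simplified]
  rule_def[of 9, unfolded base_rules_def inverse_rule_def, simplified]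
  rule_def[of 10, unfolded base_rules_def inverse_rule_def, simplified]
  rule_def[of 11, unfolded base_rules_def inverse_rule_def, simplified]
  rule_def[of 12, unfolded base_rules_def inverse_rule_def, simplified]
  rule_def[of 13, unfolded base_rules_def inverse_rule_def, simplified]
  rule_def[of 14, unfolded base_rules_def inverse_rule_def, simplified]
  rule_def[of 15, unfolded base_rules_def inverse_rule_def, simplified]
  rule_def[of 16, unfolded base_rules_def inverse_rule_def, simplified]
  rule_def[of 17, unfolded base_rules_def inverse_rule_def, simplified]
  rule_def[of 18, unfolded base_rules_def inverse_rule_def, simplified]
  rule_def[of 19, unfolded base_rules_def inverse_rule_def, simplified]
  rule_def[of 20, unfolded base_rules_def inverse_rule_def, simplified]
  rule_def[of 21, unfolded base_rules_def inverse_rule_def, simplified]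
  rule_def[of 22, unfolded base_rules_def inverse_rule_def, simplified]
  rule_def[of 23, unfolded base_rules_def inverse_rule_def, simplified]
  rule_def[of 24, unfolded base_rules_def inverse_rule_def, simplified]
  rule_def[of 25, unfolded base_rules_def inverse_rule_def, simplified]
  rule_def[of 26, unfolded base_rules_def inverse_rule_def, simplified]
  rule_def[of 27, unfolded base_rules_def inverse_rule_def, simplified]
  rule_def[of 28, unfolded base_rules_def inverse_rule_def, simplified]
  rule_def[of 29, unfolded base_rules_def inverse_rule_def, simplified]
  rule_def[of 30, unfolded base_rules_def inverse_rule_def, simplified]
  rule_def[of 31, unfolded base_rules_def inverse_rule_def, simplified]
  rule_def[of 32, unfolded base_rules_def inverse_rule_def, simplified]
  rule_def[of 33, unfolded base_rules_def inverse_rule_def, simplified]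
  rule_def[of 34, unfolded base_rules_def inverse_rule_def, simplified]
  rule_def[of 35, unfolded base_rules_def inverse_rule_def, simplified]
  rule_def[of 36, unfolded base_rules_def inverse_rule_def, simplified]
  rule_def[of 37, unfolded base_rules_def inverse_rule_def, simplified]
  rule_def[of 38, unfolded base_rules_def inverse_rule_def, simplified]
  rule_def[of 39, unfolded base_rules_def inverse_rule_def, simplified]

lemmas cert_row_simps =
  cert_row_def[of 0, unfolded cert_rows_def, simplified]
  cert_row_def[of 1, unfolded cert_rows_def, simplified]
  cert_row_def[of 2, unfolded cert_rows_def, simplified]
  cert_row_def[of 3, unfolded cert_rows_def, simplified]
  cert_row_def[of 4, unfolded cert_rows_def, simplified]
  cert_row_def[of 5, unfolded cert_rows_def, simplified]
  cert_row_def[of 6, unfolded cert_rows_def, simplified]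
  cert_row_def[of 7, unfolded cert_rows_def, simplified]
  cert_row_def[of 8, unfolded cert_rows_def, simplified]
  cert_row_def[of 9, unfolded cert_rows_def, simplified]
  cert_row_def[of 10, unfolded cert_rows_def, simplified]
  cert_row_def[of 11, unfolded cert_rows_def, simplified]
  cert_row_def[of 12, unfolded cert_rows_def, simplified]
  cert_row_def[of 13, unfolded cert_rows_def, simplified]
  cert_row_def[of 14, unfolded cert_rows_def, simplified]
  cert_row_def[of 15, unfolded cert_rows_def, simplified]
  cert_row_def[of 16, unfolded cert_rows_def, simplified]
  cert_row_def[of 17, unfolded cert_rows_def, simplified]
  cert_row_def[of 18, unfolded cert_rows_def, simplified]
  cert_row_def[of 19, unfolded cert_rows_def, simplified]
  cert_row_def[of 20, unfolded cert_rows_def, simplified]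
  cert_row_def[of 21, unfolded cert_rows_def, simplified]
  cert_row_def[of 22, unfolded cert_rows_def, simplified]
  cert_row_def[of 23, unfolded cert_rows_def, simplified]
  cert_row_def[of 24, unfolded cert_rows_def, simplified]
  cert_row_def[of 25, unfolded cert_rows_def, simplified]
  cert_row_def[of 26, unfolded cert_rows_def, simplified]
  cert_row_def[of 27, unfolded cert_rows_def, simplified]
  cert_row_def[of 28, unfolded cert_rows_def, simplified]
  cert_row_def[of 29, unfolded cert_rows_def, simplified]
  cert_row_def[of 30, unfolded cert_rows_def, simplified]
  cert_row_def[of 31, unfolded cert_rows_def, simplified]
  cert_row_def[of 32, unfolded cert_rows_def, simplified]
  cert_row_def[of 33, unfolded cert_rows_def, simplified]
  cert_row_def[of 34, unfolded cert_rows_def, simplified]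
  cert_row_def[of 35, unfolded cert_rows_def, simplified]
  cert_row_def[of 36, unfolded cert_rows_def, simplified]
  cert_row_def[of 37, unfolded cert_rows_def, simplified]
  cert_row_def[of 38, unfolded cert_rows_def, simplified]

lemmas via_row_simps =
  via_row_def[of 0, unfolded via_rows_def, simplified]
  via_row_def[of 1, unfolded via_rows_def, simplified]
  via_row_def[of 2, unfolded via_rows_def, simplified]
  via_row_def[of 3, unfolded via_rows_def, simplified]
  via_row_def[of 4, unfolded via_rows_def, simplified]
  via_row_def[of 5, unfolded via_rows_def, simplified]
  via_row_def[of 6, unfolded via_rows_def, simplified]
  via_row_def[of 7, unfolded via_rows_def, simplified]
  via_row_def[of 8, unfolded via_rows_def, simplified]
  via_row_def[of 9, unfolded via_rows_def, simplified]
  via_row_def[of 10, unfolded via_rows_def, simplified]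
  via_row_def[of 11, unfolded via_rows_def, simplified]
  via_row_def[of 12, unfolded via_rows_def, simplified]
  via_row_def[of 13, unfolded via_rows_def, simplified]
  via_row_def[of 14, unfolded via_rows_def, simplified]
  via_row_def[of 15, unfolded via_rows_def, simplified]
  via_row_def[of 16, unfolded via_rows_def, simplified]
  via_row_def[of 17, unfolded via_rows_def, simplified]
  via_row_def[of 18, unfolded via_rows_def, simplified]
  via_row_def[of 19, unfolded via_rows_def, simplified]
  via_row_def[of 20, unfolded via_rows_def, simplified]
  via_row_def[of 21, unfolded via_rows_def, simplified]
  via_row_def[of 22, unfolded via_rows_def, simplified]
  via_row_def[of 23, unfolded via_rows_def, simplified]
  via_row_def[of 24, unfolded via_rows_def, simplified]
  via_row_def[of 25, unfolded via_rows_def, simplified]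
  via_row_def[of 26, unfolded via_rows_def, simplified]
  via_row_def[of 27, unfolded via_rows_def, simplified]
  via_row_def[of 28, unfolded via_rows_def, simplified]
  via_row_def[of 29, unfolded via_rows_def, simplified]
  via_row_def[of 30, unfolded via_rows_def, simplified]
  via_row_def[of 31, unfolded via_rows_def, simplified]
  via_row_def[of 32, unfolded via_rows_def, simplified]
  via_row_def[of 33, unfolded via_rows_def, simplified]
  via_row_def[of 34, unfolded via_rows_def, simplified]
  via_row_def[of 35, unfolded via_rows_def, simplified]
  via_row_def[of 36, unfolded via_rows_def, simplified]
  via_row_def[of 37, unfolded via_rows_def, simplified]
  via_row_def[of 38, unfolded via_rows_def, simplified]

lemmas cert_partners_simps =
  cert_partners_def[of 0, unfolded cert_row_simps, simplified]
  cert_partners_def[of 1, unfolded cert_row_simps, simplified]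
  cert_partners_def[of 2, unfolded cert_row_simps, simplified]
  cert_partners_def[of 3, unfolded cert_row_simps, simplified]
  cert_partners_def[of 4, unfolded cert_row_simps, simplified]
  cert_partners_def[of 5, unfolded cert_row_simps, simplified]
  cert_partners_def[of 6, unfolded cert_row_simps, simplified]
  cert_partners_def[of 7, unfolded cert_row_simps, simplified]
  cert_partners_def[of 8, unfolded cert_row_simps, simplified]
  cert_partners_def[of 9, unfolded cert_row_simps, simplified]
  cert_partners_def[of 10, unfolded cert_row_simps, simplified]
  cert_partners_def[of 11, unfolded cert_row_simps, simplified]
  cert_partners_def[of 12, unfolded cert_row_simps, simplified]
  cert_partners_def[of 13, unfolded cert_row_simps, simplified]
  cert_partners_def[of 14, unfolded cert_row_simps, simplified]
  cert_partners_def[of 15, unfolded cert_row_simps, simplified]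
  cert_partners_def[of 16, unfolded cert_row_simps, simplified]
  cert_partners_def[of 17, unfolded cert_row_simps, simplified]
  cert_partners_def[of 18, unfolded cert_row_simps, simplified]
  cert_partners_def[of 19, unfolded cert_row_simps, simplified]
  cert_partners_def[of 20, unfolded cert_row_simps, simplified]
  cert_partners_def[of 21, unfolded cert_row_simps, simplified]
  cert_partners_def[of 22, unfolded cert_row_simps, simplified]
  cert_partners_def[of 23, unfolded cert_row_simps, simplified]
  cert_partners_def[of 24, unfolded cert_row_simps, simplified]
  cert_partners_def[of 25, unfolded cert_row_simps, simplified]
  cert_partners_def[of 26, unfolded cert_row_simps, simplified]
  cert_partners_def[of 27, unfolded cert_row_simps, simplified]
  cert_partners_def[of 28, unfolded cert_row_simps, simplified]
  cert_partners_def[of 29, unfolded cert_row_simps, simplified]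
  cert_partners_def[of 30, unfolded cert_row_simps, simplified]
  cert_partners_def[of 31, unfolded cert_row_simps, simplified]
  cert_partners_def[of 32, unfolded cert_row_simps, simplified]
  cert_partners_def[of 33, unfolded cert_row_simps, simplified]
  cert_partners_def[of 34, unfolded cert_row_simps, simplified]
  cert_partners_def[of 35, unfolded cert_row_simps, simplified]
  cert_partners_def[of 36, unfolded cert_row_simps, simplified]
  cert_partners_def[of 37, unfolded cert_row_simps, simplified]
  cert_partners_def[of 38, unfolded cert_row_simps, simplified]

lemmas eval_simps =
  red.simps mdiv.simps padd.simps pmul.simps mmul.simps mdiff.simps mless.simps
  prod.case option.case option.map fst_conv snd_conv if_True if_False simp_thms
  list.inject list.distinct list.set list.pred_inject insert_iff empty_iff
  arith_simps rel_simps one_add_one one_plus_numeral numeral_plus_one Num.inc.simps sub_num_simps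
  diff_numeral_simps diff_numeral_special add_neg_numeral_special
  mult_1_left mult_1_right mult_minus_left mult_minus_right minus_minus minus_zero neg_equal_iff_equal
  right_minus left_minus add_0_left add_0_right

lemma spairs_ok_0:
  "spairs_ok 0" "spairs_ok 1" "spairs_ok 2" "spairs_ok 3" "spairs_ok 4" "spairs_ok 5"
  "spairs_ok 6" "spairs_ok 7" "spairs_ok 8" "spairs_ok 9" "spairs_ok 10" "spairs_ok 11"
  by (simp_all only: spairs_ok_def spair_ok_def cofactors_def Let_def rule_simps cert_row_simps eval_simps
      cong: if_weak_cong option.case_cong_weak)

lemma spairs_ok_12:
  "spairs_ok 12" "spairs_ok 13" "spairs_ok 14" "spairs_ok 15" "spairs_ok 16" "spairs_ok 17"
  by (simp_all only: spairs_ok_def spair_ok_def cofactors_def Let_def rule_simps cert_row_simps eval_simps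
      cong: if_weak_cong option.case_cong_weak)

lemma spairs_ok_18:
  "spairs_ok 18" "spairs_ok 19" "spairs_ok 20"
  by (simp_all only: spairs_ok_def spair_ok_def cofactors_def Let_def rule_simps cert_row_simps eval_simps
      cong: if_weak_cong option.case_cong_weak)

lemma spairs_ok_21:
  "spairs_ok 21" "spairs_ok 22" "spairs_ok 23" "spairs_ok 24"
  by (simp_all only: spairs_ok_def spair_ok_def cofactors_def Let_def rule_simps cert_row_simps eval_simps
      cong: if_weak_cong option.case_cong_weak)

lemma spairs_ok_25:
  "spairs_ok 25" "spairs_ok 26" "spairs_ok 27"
  by (simp_all only: spairs_ok_def spair_ok_def cofactors_def Let_def rule_simps cert_row_simps eval_simps
      cong: if_weak_cong option.case_cong_weak)

lemma spairs_ok_28: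
  "spairs_ok 28" "spairs_ok 29"
  by (simp_all only: spairs_ok_def spair_ok_def cofactors_def Let_def rule_simps cert_row_simps eval_simps
      cong: if_weak_cong option.case_cong_weak)

lemma spairs_ok_30:
  "spairs_ok 30" "spairs_ok 31"
  by (simp_all only: spairs_ok_def spair_ok_def cofactors_def Let_def rule_simps cert_row_simps eval_simps
      cong: if_weak_cong option.case_cong_weak)

lemma spairs_ok_32:
  "spairs_ok 32"
  by (simp_all only: spairs_ok_def spair_ok_def cofactors_def Let_def rule_simps cert_row_simps eval_simps
      cong: if_weak_cong option.case_cong_weak)

lemma spairs_ok_33:
  "spairs_ok 33" "spairs_ok 34" "spairs_ok 35" "spairs_ok 36"
  by (simp_all only: spairs_ok_def spair_ok_def cofactors_def Let_def rule_simps cert_row_simps eval_simps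
      cong: if_weak_cong option.case_cong_weak)

lemma spairs_ok_37:
  "spairs_ok 37" "spairs_ok 38"
  by (simp_all only: spairs_ok_def spair_ok_def cofactors_def Let_def rule_simps cert_row_simps eval_simps
      cong: if_weak_cong option.case_cong_weak)

lemma vias_ok:
  "vias_ok 0" "vias_ok 1" "vias_ok 2" "vias_ok 3" "vias_ok 4" "vias_ok 5" "vias_ok 6" "vias_ok 7"
  "vias_ok 8" "vias_ok 9" "vias_ok 10" "vias_ok 11" "vias_ok 12" "vias_ok 13" "vias_ok 14"
  "vias_ok 15" "vias_ok 16" "vias_ok 17" "vias_ok 18" "vias_ok 19" "vias_ok 20" "vias_ok 21"
  "vias_ok 22" "vias_ok 23" "vias_ok 24" "vias_ok 25" "vias_ok 26" "vias_ok 27" "vias_ok 28"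
  "vias_ok 29" "vias_ok 30" "vias_ok 31" "vias_ok 32" "vias_ok 33" "vias_ok 34" "vias_ok 35"
  "vias_ok 36" "vias_ok 37" "vias_ok 38"
  by (simp_all add: vias_ok_def adjacent_def coprime_ok_def divides_lcm_def cofactors_def Let_def
      rule_simps via_row_simps cert_partners_simps)

lemma covered:
  "covered 0" "covered 1" "covered 2" "covered 3" "covered 4" "covered 5" "covered 6" "covered 7"
  "covered 8" "covered 9" "covered 10" "covered 11" "covered 12" "covered 13" "covered 14"
  "covered 15" "covered 16" "covered 17" "covered 18" "covered 19" "covered 20" "covered 21"
  "covered 22" "covered 23" "covered 24" "covered 25" "covered 26" "covered 27" "covered 28"
  "covered 29" "covered 30" "covered 31" "covered 32" "covered 33" "covered 34" "covered 35"
  "covered 36" "covered 37" "covered 38"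
  by (simp_all add: covered_def adjacent_def coprime_ok_def rule_simps via_row_simps cert_partners_simps indices_def)

text \<open>This disposes of all S-polynomials with the relation for \<open>t\<close> by the first
  criterion, whence adding that relation creates no new rules.\<close>

lemma inverse_rule_coprime: "list_all (coprime_ok 39) indices"
  by (simp add: coprime_ok_def rule_simps indices_def)

lemma int_less_39:
  assumes "list_all P indices" "0 \<le> i" "i < 39"
  shows "P i"
proof -
  have "i \<in> set indices"
    using assms(2,3) unfolding indices_def by simp presburger
  then show ?thesis using assms(1) by (simp add: list_all_iff)
qed

lemma all_spairs_ok: "list_all spairs_ok indices"
  unfolding indices_def list.pred_inject by (intro conjI list.pred_inject(1)
    spairs_ok_0 spairs_ok_12 spairs_ok_18 spairs_ok_21 spairs_ok_25 spairs_ok_28 spairs_ok_30 spairs_ok_32 spairs_ok_33 spairs_ok_37)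

lemma joins_cert:
  assumes "j \<in> set (cert_partners i)" "0 \<le> i" "i < 39"
  shows "joins TYPE('a::comm_ring_1) i j"
proof -
  obtain "is" where "(j, is) \<in> set (cert_row i)"
    using assms(1) by (auto simp: cert_partners_def)
  then have "spair_ok i j is"
    using int_less_39[OF all_spairs_ok assms(2,3)] by (auto simp: spairs_ok_def list_all_iff)
  then show ?thesis by (rule joins_spair)
qed

lemma joins_adjacent:
  assumes "adjacent i j" "0 \<le> i" "i < 39" "0 \<le> j" "j < 39"
  shows "joins TYPE('a::comm_ring_1) i j"
  using assms(1) unfolding adjacent_def
proof (elim disjE)
  assume "coprime_ok i j"
  then show ?thesis by (rule joins_coprime)
next
  assume "j \<in> set (cert_partners i)"
  then show ?thesis using assms by (intro joins_cert)
next
  assume "i \<in> set (cert_partners j)"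
  then have "joins TYPE('a) j i" using assms by (intro joins_cert)
  then show ?thesis by (rule grobner.joinable_sym)
qed

lemma joins_less:
  assumes "0 \<le> j" "j < i" "i < 39"
  shows "joins TYPE('a::comm_ring_1) i j"
proof -
  have i: "0 \<le> i" using assms by simp
  have "list_all covered indices" unfolding indices_def by (simp add: covered)
  from int_less_39[OF this i assms(3)]
  have "list_all (\<lambda>j. j < i \<longrightarrow> adjacent i j \<or> j \<in> set (map fst (via_row i))) indices"
    by (simp add: covered_def)
  from int_less_39[OF this assms(1)] assms(2,3)
  have "adjacent i j \<or> j \<in> fst ` set (via_row i)" by simp
  then consider "adjacent i j" | k where "(j, k) \<in> set (via_row i)" by force
  then show ?thesis
  proof cases
    case 1
    then show ?thesis using assms i by (intro joins_adjacent) auto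
  next
    case 2
    have "list_all vias_ok indices" unfolding indices_def by (simp add: vias_ok)
    from int_less_39[OF this i assms(3)] 2
    have k: "0 \<le> k" "k < 39" "adjacent i k" "adjacent k j" "divides_lcm i j k"
      by (auto simp: vias_ok_def list_all_iff)
    have "joins TYPE('a) i k" "joins TYPE('a) k j"
      using k assms i by (auto intro: joins_adjacent)
    then show ?thesis using k(5) by (rule joins_via)
  qed
qed

lemma joins_le:
  assumes "0 \<le> j" "j \<le> i" "i < 40"
  shows "joins TYPE('a::comm_ring_1) i j"
proof -
  consider "j = i" | "j < i" "i < 39" | "i = 39" "j < 39" using assms by linarith
  then show ?thesis
  proof cases
    case 1
    then show ?thesis by (simp add: grobner.joinable_refl)
  next
    case 2
    then show ?thesis using assms by (intro joins_less)
  next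
    case 3
    then show ?thesis using int_less_39[OF inverse_rule_coprime, of j] assms
      by (intro joins_coprime) simp
  qed
qed

lemma rules_confluent:
  assumes "r \<in> decode_rule ` rules" "s \<in> decode_rule ` rules"
  shows "grobner.joinable (r :: (int, 'a::comm_ring_1) rule) s"
proof -
  obtain r' s' where rs: "r' \<in> rules" "r = decode_rule r'" "s' \<in> rules" "s = decode_rule s'"
    using assms by blast
  obtain i j where ij: "0 \<le> i" "i < 40" "r' = rule i" "0 \<le> j" "j < 40" "s' = rule j"
    using rules_rule[OF rs(1)] rules_rule[OF rs(3)] by metis
  show ?thesis
  proof (cases "j \<le> i")
    case True
    then show ?thesis unfolding rs ij using ij by (intro joins_le)
  next
    case False
    then have "joins TYPE('a) j i" using ij by (intro joins_le) auto
    then show ?thesis unfolding rs ij by (rule grobner.joinable_sym)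
  qed
qed

section \<open>Comparison of the two generating sets\<close>

text \<open>Values in an arbitrary commutative ring, since the same identities are used in
  \<open>S\<close> at its coordinates and in the polynomial ring with \<open>t\<close> at the
  variables.\<close>

definition evalc :: "(int \<Rightarrow> 'r::comm_ring_1) \<Rightarrow> coded \<Rightarrow> 'r" where
  "evalc x q = (\<Sum>(k, c)\<leftarrow>q. of_int c * prod_list (map x k))"

definition rule_value :: "(int \<Rightarrow> 'r::comm_ring_1) \<Rightarrow> int list \<times> coded \<Rightarrow> 'r" where
  "rule_value x r = prod_list (map x (fst r)) - evalc x (snd r)"

lemma evalc_simps [simp]:
  "evalc x [] = 0" "evalc x ((k, c) # q) = of_int c * prod_list (map x k) + evalc x q"
  by (simp_all add: evalc_def)

lemma single_of_int: "Poly_Mapping.single 0 (of_int c) = (of_int c :: ('v, 'a::comm_ring_1) mpoly)"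
proof -
  have "Poly_Mapping.single 0 (of_nat n) = (of_nat n :: ('v, 'a) mpoly)" for n
    by (induction n) (simp_all add: single_add)
  then show ?thesis by (cases c) (simp_all add: single_uminus single_add single_diff)
qed

lemma subst_single_mon:
  "subst \<sigma> (Poly_Mapping.single (mon l) c) = Poly_Mapping.single 0 c * prod_list (map \<sigma> l)"
proof -
  have "mon_subst \<sigma> (mon l) = prod_list (map \<sigma> l)"
  proof (induction l)
    case (Cons i l)
    have "mon_subst \<sigma> (Poly_Mapping.single i 1) = \<sigma> i" by (simp add: mon_subst_def)
    then show ?case using Cons by (simp add: mon_Cons mon_subst_add)
  qed (simp add: mon_subst_def)
  then show ?thesis by (simp add: subst_single)
qed

lemma subst_decode: "subst \<sigma> (tail_poly (decode q)) = evalc \<sigma> q"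
  by (induction q) (auto simp: subst_add subst_0 subst_single_mon single_of_int split: prod.splits)

lemma subst_rule_poly: "subst \<sigma> (rule_poly (decode_rule r)) = rule_value \<sigma> r"
  by (simp add: rule_poly_def rule_value_def subst_diff subst_decode subst_single_mon single_one)

section \<open>The numbering of the coordinates\<close>

fun code_of :: "sl3_coord + sl3_coord \<Rightarrow> int" where
  "code_of (Inl X11) = 6"
| "code_of (Inl X12) = 11"
| "code_of (Inl X13) = 8"
| "code_of (Inl X21) = 7"
| "code_of (Inl X22) = 10"
| "code_of (Inl X23) = 15"
| "code_of (Inl X31) = 12"
| "code_of (Inl X32) = 9"
| "code_of (Inr X11) = 3"
| "code_of (Inr X12) = 1"
| "code_of (Inr X13) = 0"
| "code_of (Inr X21) = 13"
| "code_of (Inr X22) = 4"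
| "code_of (Inr X23) = 2"
| "code_of (Inr X31) = 14"
| "code_of (Inr X32) = 5"

text \<open>The value at 16 is unspecified, so substitution along \<open>coord_of\<close> sends
  \<open>t\<close> to some variable. This does no harm, as \<open>t\<close> occurs in none of the 39
  rules.\<close>

definition coord_of :: "int \<Rightarrow> sl3_coord + sl3_coord" where
  "coord_of i = [Inr X13, Inr X12, Inr X23, Inr X11, Inr X22, Inr X32, Inl X11, Inl X21, Inl X13,
    Inl X32, Inl X22, Inl X12, Inl X31, Inr X21, Inr X31, Inl X23] ! nat i"

lemma coord_of_code_of [simp]: "coord_of (code_of v) = v"
  by (cases v; cases "projl v"; cases "projr v"; simp add: coord_of_def)

abbreviation gM :: "(int \<Rightarrow> 'r::comm_ring_1) \<Rightarrow> 'r^3^3" where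
  "gM x \<equiv> sl3_matrix (\<lambda>e. x (code_of (Inl e)))"

abbreviation gN :: "(int \<Rightarrow> 'r::comm_ring_1) \<Rightarrow> 'r^3^3" where
  "gN x \<equiv> sl3_matrix (\<lambda>e. x (code_of (Inr e)))"

text \<open>Each rule is an explicit combination of the listed traces and entries. The factor 6
  clears denominators: multiples of 1/2 occur at the traces of \<open>M^2\<close> and
  \<open>N^2\<close>, and 1/3 at the traces of the cubes.\<close>

lemma rule_value_rule:
  fixes x :: "int \<Rightarrow> 'r::comm_ring_1"
  shows
    "6 * rule_value x (rule 0) = 3 * trace (gN x ** gN x)"
    "6 * rule_value x (rule 1) = 3 * trace (gM x ** gM x)"
    "6 * rule_value x (rule 2) = 6 * trace (gM x ** gN x)"
    "6 * rule_value x (rule 3) = 2 * trace (gN x ** gN x ** gN x) + (3 * x 3) * trace (gN x ** gN x)"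
    "6 * rule_value x (rule 4) = 6 * (gN x ** gN x ** gM x) $ 1 $ 1"
    "6 * rule_value x (rule 5) = 6 * (gN x ** gN x ** gM x) $ 1 $ 3"
    "6 * rule_value x (rule 6) = 6 * (gN x ** gN x ** gM x) $ 1 $ 2 + (- 6 * x 1) * trace (gM x ** gN x)"
    "6 * rule_value x (rule 7) = (- 6 * x 0) * trace (gM x ** gN x) + 6 * (gM x ** gN x ** gN x) $ 1 $ 3
        + (- 3 * x 8) * trace (gN x ** gN x)"
    "6 * rule_value x (rule 8) = (- 6) * (gM x ** gN x ** gN x) $ 3 $ 3 + (- 3 * x 10) * trace (gN x ** gN x)
        + (- 3 * x 6) * trace (gN x ** gN x)"
    "6 * rule_value x (rule 9) = 6 * (gM x ** gN x ** gN x) $ 2 $ 3 + (- 3 * x 15) * trace (gN x ** gN x)"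
    "6 * rule_value x (rule 10) = (- 6) * (gN x ** gN x ** gM x) $ 1 $ 2 + (6 * x 1) * trace (gM x ** gN x)
        + (- 6) * (gM x ** gN x ** gN x) $ 1 $ 2 + (3 * x 11) * trace (gN x ** gN x)"
    "6 * rule_value x (rule 11) = 6 * (gM x ** gN x ** gN x) $ 3 $ 2 + (- 3 * x 9) * trace (gN x ** gN x)"
    "6 * rule_value x (rule 12) = 6 * (gM x ** gN x ** gN x) $ 3 $ 3 + (- 6) * (gM x ** gN x ** gN x) $ 2 $ 2
        + (6 * x 10) * trace (gN x ** gN x) + (3 * x 6) * trace (gN x ** gN x)"
    "6 * rule_value x (rule 13) = 6 * (gN x ** gM x ** gM x) $ 1 $ 1"
    "6 * rule_value x (rule 14) = 6 * (gN x ** gM x ** gM x) $ 1 $ 2 + (- 3 * x 1) * trace (gM x ** gM x)"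
    "6 * rule_value x (rule 15) = 6 * (gN x ** gM x ** gM x) $ 1 $ 3 + (- 3 * x 0) * trace (gM x ** gM x)"
    "6 * rule_value x (rule 16) = 6 * (gN x ** gN x ** gM x) $ 2 $ 1 + (- 3 * x 7) * trace (gN x ** gN x)"
    "6 * rule_value x (rule 17) = (- 6) * (gM x ** gM x ** gN x) $ 2 $ 3 + (3 * x 2) * trace (gM x ** gM x)"
    "6 * rule_value x (rule 18) = (3 * x 4) * trace (gM x ** gM x) + 6 * (gM x ** gM x ** gN x) $ 3 $ 3
        + (3 * x 3) * trace (gM x ** gM x)"
    "6 * rule_value x (rule 19) = 6 * (gN x ** gN x ** gM x) $ 2 $ 3 + (- 6 * x 15) * trace (gN x ** gN x)
        + 6 * (gM x ** gN x ** gN x) $ 2 $ 3"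
    "6 * rule_value x (rule 20) = (6 * x 4) * trace (gM x ** gN x) + (6 * x 3) * trace (gM x ** gN x)
        + (- 3 * x 10) * trace (gN x ** gN x) + 6 * (gN x ** gN x ** gM x) $ 3 $ 3
        + (- 6) * (gM x ** gN x ** gN x) $ 1 $ 1"
    "6 * rule_value x (rule 21) = (- 6) * (gM x ** gM x ** gN x) $ 1 $ 3 + (- 6) * (gN x ** gM x ** gM x) $ 1 $ 3
        + (3 * x 0) * trace (gM x ** gM x)"
    "6 * rule_value x (rule 22) = 6 * (gN x ** gN x ** gM x) $ 3 $ 1 + (- 3 * x 12) * trace (gN x ** gN x)"
    "6 * rule_value x (rule 23) = 6 * (gM x ** gM x ** gN x) $ 2 $ 2 + (- 3 * x 4) * trace (gM x ** gM x)"
    "6 * rule_value x (rule 24) = (- 6) * (gM x ** gM x ** gN x) $ 3 $ 2 + (3 * x 5) * trace (gM x ** gM x)"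
    "6 * rule_value x (rule 25) = (6 * x 4) * trace (gM x ** gN x) + (6 * x 3) * trace (gM x ** gN x)
        + (- 6) * (gM x ** gN x ** gN x) $ 2 $ 2 + (3 * x 10) * trace (gN x ** gN x)
        + 12 * (gN x ** gN x ** gM x) $ 3 $ 3 + (- 6) * (gM x ** gN x ** gN x) $ 1 $ 1
        + (3 * x 6) * trace (gN x ** gN x)"
    "6 * rule_value x (rule 26) = (9 * x 9) * trace (gN x ** gN x) + (6 * x 5) * trace (gM x ** gN x)
        + (- 12) * (gM x ** gN x ** gN x) $ 3 $ 2 + (- 6) * (gN x ** gN x ** gM x) $ 3 $ 2"
    "6 * rule_value x (rule 27) = (- 6) * (gM x ** gN x ** gN x) $ 3 $ 1 + (- 6) * (gN x ** gN x ** gM x) $ 3 $ 1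
        + (3 * x 12) * trace (gN x ** gN x)"
    "6 * rule_value x (rule 28) = 6 * (gM x ** gM x ** gN x) $ 1 $ 2"
    "6 * rule_value x (rule 29) = 6 * (gM x ** gN x ** gN x) $ 2 $ 1"
    "6 * rule_value x (rule 30) = (- 6 * x 12) * trace (gM x ** gN x) + 6 * (gN x ** gM x ** gM x) $ 3 $ 1
        + 6 * (gM x ** gM x ** gN x) $ 3 $ 1 + (- 3 * x 14) * trace (gM x ** gM x)"
    "6 * rule_value x (rule 31) = (- 6) * (gN x ** gM x ** gM x) $ 2 $ 1 + (- 6) * (gM x ** gM x ** gN x) $ 2 $ 1
        + (3 * x 13) * trace (gM x ** gM x) + (6 * x 7) * trace (gM x ** gN x)"
    "6 * rule_value x (rule 32) = (3 * x 4) * trace (gM x ** gM x) + (6 * x 10) * trace (gM x ** gN x)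
        + 6 * (gN x ** gM x ** gM x) $ 1 $ 1 + (- 6) * (gN x ** gM x ** gM x) $ 2 $ 2
        + 12 * (gM x ** gM x ** gN x) $ 3 $ 3 + (3 * x 3) * trace (gM x ** gM x)
        + (6 * x 6) * trace (gM x ** gN x)"
    "6 * rule_value x (rule 33) = 6 * (gN x ** gM x ** gM x) $ 2 $ 1 + (- 6 * x 7) * trace (gM x ** gN x)"
    "6 * rule_value x (rule 34) = 6 * (gN x ** gM x ** gM x) $ 3 $ 1"
    "6 * rule_value x (rule 35) = (6 * x 2) * trace (gM x ** gM x) + (6 * x 15) * trace (gM x ** gN x)
        + (- 6) * (gM x ** gM x ** gN x) $ 2 $ 3 + (- 6) * (gN x ** gM x ** gM x) $ 2 $ 3"
    "6 * rule_value x (rule 36) = 6 * (gN x ** gM x ** gM x) $ 3 $ 2 + (- 3 * x 5) * trace (gM x ** gM x)"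
    "6 * rule_value x (rule 37) = 2 * trace (gM x ** gM x ** gM x) + (3 * x 6) * trace (gM x ** gM x)"
    "6 * rule_value x (rule 38) = (3 * x 3) * trace (gM x ** gM x) + (6 * x 10) * trace (gM x ** gN x)
        + 12 * (gM x ** gM x ** gN x) $ 3 $ 3 + 6 * (gM x ** gM x ** gN x) $ 1 $ 1
        + (- 12) * (gN x ** gM x ** gM x) $ 2 $ 2 + (6 * x 4) * trace (gM x ** gM x)
        + (6 * x 6) * trace (gM x ** gN x)"
  by (simp_all add: rule_value_def rule_simps mult3_nth trace3 sl3_matrix_nth algebra_simps)

lemma rule_value_mem:
  fixes J :: "'r::comm_ring_1 set" and x :: "int \<Rightarrow> 'r"
  assumes J: "ideal J ring_of_type_algebra" and u: "u * 6 = (1 :: 'r)"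
    and tr: "trace (gM x ** gM x) \<in> J" "trace (gN x ** gN x) \<in> J" "trace (gM x ** gN x) \<in> J"
      "trace (gM x ** gM x ** gM x) \<in> J" "trace (gN x ** gN x ** gN x) \<in> J"
    and pr: "\<And>i j. (gM x ** gM x ** gN x) $ i $ j \<in> J" "\<And>i j. (gN x ** gN x ** gM x) $ i $ j \<in> J"
      "\<And>i j. (gN x ** gM x ** gM x) $ i $ j \<in> J" "\<And>i j. (gM x ** gN x ** gN x) $ i $ j \<in> J"
    and r: "r \<in> set base_rules"
  shows "rule_value x r \<in> J"
proof -
  note c = type_ideal_closed[OF J]
  have 6: "list_all (\<lambda>i. 6 * rule_value x (rule i) \<in> J) indices"
    unfolding indices_def list.pred_inject rule_value_rule
    by (intro conjI list.pred_inject(1) c(2) c(3) tr pr)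
  obtain n where n: "n < length base_rules" "r = base_rules ! n"
    using r by (auto simp: in_set_conv_nth)
  then have "n < 39" by (simp add: base_rules_def)
  then have "6 * rule_value x r \<in> J"
    using int_less_39[OF 6, of "int n"] n(2) by (simp add: rule_def)
  \<comment> \<open>Division by 6; the hypothesis on the characteristic is spent here.\<close>
  from c(3)[OF this, of u] show ?thesis by (simp add: u flip: mult.assoc)
qed

lemma subst_Var_id: "subst Var p = p"
  by (induction p rule: mpoly_induct) (simp_all add: subst_const subst_add subst_mult)

lemma rule_poly_eq: "rule_poly (decode_rule r) = rule_value Var r"
  using subst_rule_poly[of Var r] by (simp add: subst_Var_id)

lemma inverse_rule_value:
  "rule_value x inverse_rule = x 16 * (gN x ** gN x) $ 1 $ 3 - 1"
  by (simp add: inverse_rule_def rule_value_def mult3_nth sl3_matrix_nth algebra_simps)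

text \<open>These identities supply the hypotheses of \<open>chart_entry\<close>: the last column
  and the first row of \<open>N^2\<close> are annihilated modulo the rules. Stated through the rules
  instead of the original generators, they have integral coefficients.\<close>

lemma null_row_column:
  fixes x :: "int \<Rightarrow> 'r::comm_ring_1"
  shows
    "(gM x ** (gN x ** gN x)) $ 1 $ 3 = x 8 * rule_value x (rule 0) + rule_value x (rule 7) + x 0 * rule_value x (rule 2)"
    "(gM x ** (gN x ** gN x)) $ 2 $ 3 = x 15 * rule_value x (rule 0) + rule_value x (rule 9)"
    "((gN x ** gN x) ** gM x) $ 1 $ 1 = rule_value x (rule 4)"
    "((gN x ** gN x) ** gM x) $ 1 $ 2 = rule_value x (rule 6) + x 1 * rule_value x (rule 2)"
    "((gN x ** gN x) ** gM x) $ 1 $ 3 = rule_value x (rule 5)"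
    "(gN x ** (gN x ** gN x)) $ 1 $ 3 = x 0 * rule_value x (rule 0)"
    "(gN x ** (gN x ** gN x)) $ 2 $ 3 = x 2 * rule_value x (rule 0)"
    "(gN x ** (gN x ** gN x)) $ 3 $ 3 = - (x 4 + 2 * x 3) * rule_value x (rule 0) + rule_value x (rule 3)"
    "((gN x ** gN x) ** gN x) $ 1 $ 1 = rule_value x (rule 3)"
    "((gN x ** gN x) ** gN x) $ 1 $ 2 = x 1 * rule_value x (rule 0)"
  by (simp_all add: rule_value_def rule_simps mult3_nth sl3_matrix_nth algebra_simps)

section \<open>The chart\<close>

abbreviation chart_ideal :: "(int, 'f::comm_ring_1) mpoly set" where
  "chart_ideal \<equiv> genideal ring_of_type_algebra (rule_poly ` decode_rule ` rules)"

lemma rule_value_in_chart_ideal: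
  "r \<in> rules \<Longrightarrow> rule_value Var r \<in> (chart_ideal :: (int, 'f::comm_ring_1) mpoly set)"
  using ring.genideal_self[OF ring_from_type_algebra, of "rule_poly ` decode_rule ` rules :: (int, 'f) mpoly set"]
  by (auto simp flip: rule_poly_eq)

definition chart_N2 :: "(int, 'f::comm_ring_1) mpoly^3^3" where
  "chart_N2 = gN Var ** gN Var"

definition chart_a :: "(int, 'f::comm_ring_1) mpoly" where
  "chart_a = Var 16 * chart_N2 $ 2 $ 3"

definition chart_b :: "(int, 'f::comm_ring_1) mpoly" where
  "chart_b = - Var 16 * chart_N2 $ 1 $ 2"

definition chart_c :: "(int, 'f::comm_ring_1) mpoly" where
  "chart_c = Var 16 * chart_N2 $ 3 $ 3"

text \<open>A section over the locus where \<open>f\<close> is invertible: the lower unipotent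
  matrix is read off from \<open>N^2\<close>, and \<open>M\<close> and \<open>N\<close> are
  conjugated by its inverse, keeping the part above the diagonal.\<close>

primrec chart_coord :: "gnn_coord \<Rightarrow> (int, 'f::comm_ring_1) mpoly" where
  "chart_coord (G_entry i j) = chart_g chart_a chart_b chart_c $ i $ j"
| "chart_coord (U_entry e) = chart_n chart_a chart_b (gM Var) e"
| "chart_coord (V_entry e) = chart_n chart_a chart_b (gN Var) e"

lemma map_chart:
  "map_matrix3 (subst chart_coord) gnn_g = chart_g chart_a chart_b chart_c"
  "map_matrix3 (subst chart_coord) gnn_U = n_matrix (chart_n chart_a chart_b (gM Var))"
  "map_matrix3 (subst chart_coord) gnn_V = n_matrix (chart_n chart_a chart_b (gN Var))"
  by (simp add: map_matrix3_def gnn_g_def vec_eq_iff,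
      simp_all add: matrix3_eq_iff map_matrix3_def gnn_U_def gnn_V_def n_matrix_nth subst_0)

text \<open>The section followed by the map to pairs of matrices is the identity modulo
  \<open>chart_ideal\<close>. This is \<open>chart_entry\<close> for \<open>M\<close> and for
  \<open>N\<close>, applied to the last column and the first row of \<open>N^2\<close>.\<close>

lemma subst_chart_Ad_coord:
  "subst chart_coord (Ad_coord v) - Var (code_of v) \<in> (chart_ideal :: (int, 'f::comm_ring_1) mpoly set)"
proof -
  let ?J = "chart_ideal :: (int, 'f) mpoly set"
  let ?N2 = "chart_N2 :: (int, 'f) mpoly^3^3"
  have J: "ideal ?J ring_of_type_algebra" by (rule ideal_genideal)
  note c = type_ideal_closed[OF J]
  note mem = rule_value_in_chart_ideal[OF rule_in_rules]
  have tf: "Var 16 * ?N2 $ 1 $ 3 - 1 \<in> ?J"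
    using rule_value_in_chart_ideal[of inverse_rule, where 'f = 'f]
    by (simp add: inverse_rule_value chart_N2_def rules_def)
  have e: "(gM Var ** ?N2) $ 1 $ 3 \<in> ?J" "(gM Var ** ?N2) $ 2 $ 3 \<in> ?J"
    "(?N2 ** gM Var) $ 1 $ 1 \<in> ?J" "(?N2 ** gM Var) $ 1 $ 2 \<in> ?J" "(?N2 ** gM Var) $ 1 $ 3 \<in> ?J"
    "(gN Var ** ?N2) $ 1 $ 3 \<in> ?J" "(gN Var ** ?N2) $ 2 $ 3 \<in> ?J" "(gN Var ** ?N2) $ 3 $ 3 \<in> ?J"
    "(?N2 ** gN Var) $ 1 $ 1 \<in> ?J" "(?N2 ** gN Var) $ 1 $ 2 \<in> ?J"
    unfolding chart_N2_def null_row_column by (intro c(2) c(3) mem)+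
  \<comment> \<open>As \<open>N\<close> commutes with its square, the third row condition for
    \<open>N\<close> is its first column condition.\<close>
  have N3: "?N2 ** gN Var = gN Var ** ?N2" by (simp add: chart_N2_def matrix_mul_assoc)
  \<comment> \<open>That the line lies in the plane is the vanishing of an entry of
    \<open>N^4\<close>, which follows from that of the last column of \<open>N^3\<close>.\<close>
  have N4: "(?N2 ** ?N2) $ 1 $ 3 \<in> ?J"
  proof -
    have "?N2 ** ?N2 = gN Var ** (gN Var ** ?N2)"
      by (simp add: chart_N2_def matrix_mul_assoc)
    then show ?thesis
      by (simp only: mult3_nth[of "gN Var" "gN Var ** ?N2"]) (intro c(2) c(3) e)
  qed
  have M: "sl3_entry (chart_g chart_a chart_b chart_c ** n_matrix (chart_n chart_a chart_b (gM Var)) **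
      adjugate (chart_g chart_a chart_b chart_c)) e - sl3_entry (gM Var) e \<in> ?J" for e
    unfolding chart_a_def chart_b_def chart_c_def
    by (rule chart_entry[OF J tf, where ?w1.0 = "?N2 $ 1 $ 1"]) (use e N4 in \<open>simp_all add: mult3_nth sl3_matrix_nth\<close>)
  have N: "sl3_entry (chart_g chart_a chart_b chart_c ** n_matrix (chart_n chart_a chart_b (gN Var)) **
      adjugate (chart_g chart_a chart_b chart_c)) e - sl3_entry (gN Var) e \<in> ?J" for e
    unfolding chart_a_def chart_b_def chart_c_def
    by (rule chart_entry[OF J tf, where ?w1.0 = "?N2 $ 1 $ 1"])
      (use e(6-10) e(6)[folded N3] N4 in \<open>simp_all add: mult3_nth sl3_matrix_nth\<close>)
  have entry: "sl3_entry (sl3_matrix x) e = x e" for x :: "sl3_coord \<Rightarrow> (int, 'f) mpoly" and e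
    by (cases e) (simp_all add: sl3_matrix_nth)
  show ?thesis
    by (cases v) (use M N in \<open>simp_all add: map_matrix3_subst map_chart entry\<close>)
qed

text \<open>The matrix \<open>chart_g\<close> has determinant exactly 1, so the defining relation of
  the group goes to 0 and not merely into \<open>chart_ideal\<close>.\<close>

lemma subst_chart_gnn_ideal: "x \<in> gnn_ideal \<Longrightarrow> subst chart_coord x = 0"
proof -
  assume x: "x \<in> gnn_ideal"
  have "ideal {0 :: (int, 'a) mpoly} ring_of_type_algebra" by (rule type_idealI) auto
  from subst_genideal[OF this _ x[unfolded gnn_ideal_def], of chart_coord]
  show ?thesis
    by (simp add: subst_diff subst_1 map_matrix3_subst map_chart det_chart_g)
qed

section \<open>Elimination of the variable \<open>t\<close>\<close>

lemma keys_subst_code_of: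
  fixes p :: "(sl3_coord + sl3_coord, 'f::comm_ring_1) mpoly"
  shows "\<forall>u\<in>Poly_Mapping.keys (subst (\<lambda>v. Var (code_of v)) p). Poly_Mapping.lookup u 16 = 0"
proof (induction p rule: mpoly_induct)
  case (const c)
  then show ?case by (simp add: subst_const)
next
  case (Var v)
  have "code_of v \<noteq> 16" by (cases v rule: code_of.cases) simp_all
  then show ?case unfolding subst_Var by (simp add: Var_def lookup_single)
next
  case (add p q)
  then show ?case using keys_add[of "subst (\<lambda>v. Var (code_of v)) p" "subst (\<lambda>v. Var (code_of v)) q"]
    by (auto simp: subst_add)
next
  case (mult p q)
  then show ?case using keys_mult[of "subst (\<lambda>v. Var (code_of v)) p" "subst (\<lambda>v. Var (code_of v)) q"]
    by (fastforce simp: subst_mult lookup_add)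
qed

lemma base_rules_free_of_inverse:
  "list_all (\<lambda>r. list_all (\<lambda>x. 16 \<notin> set (fst x)) (snd r)) base_rules"
  by (simp add: base_rules_def)

lemma kernel_subset:
  fixes p :: "'f::comm_ring_1 S" and J :: "'f S set"
  assumes J: "ideal J ring_of_type_algebra"
    and rules: "\<And>r. r \<in> set base_rules \<Longrightarrow> rule_value (\<lambda>i. Var (coord_of i)) r \<in> J"
    and p: "subst Ad_coord p \<in> gnn_ideal"
  shows "p \<in> J"
proof -
  let ?C = "chart_ideal :: (int, 'f) mpoly set"
  let ?R = "decode_rule ` set base_rules :: (int, 'f) rule set"
  let ?J0 = "genideal ring_of_type_algebra (rule_poly ` ?R)"
  let ?p = "subst (\<lambda>v. Var (code_of v)) p"
  note c = type_ideal_closed[OF ideal_genideal]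
  \<comment> \<open>Pulled back along the map and then along the section, \<open>p\<close> becomes
    0. Since the composite is the identity modulo \<open>?C\<close>, the renamed \<open>p\<close>
    lies in \<open>?C\<close>.\<close>
  have "subst (\<lambda>v. subst chart_coord (Ad_coord v)) p - ?p \<in> ?C"
    by (intro subst_cong_ideal ideal_genideal subst_chart_Ad_coord)
  moreover have "subst (\<lambda>v. subst chart_coord (Ad_coord v)) p = 0"
    using subst_chart_gnn_ideal[OF p] by (simp add: subst_subst)
  ultimately have pC: "?p \<in> ?C" using c(5) by fastforce
  have P: "Poly_Mapping.lookup (m + fst x) 16 = 0"
    if r: "r \<in> ?R" "Poly_Mapping.lookup (m + fst r) 16 = 0" "x \<in> set (snd r)" for m r x
  proof -
    obtain r' where r': "r' \<in> set base_rules" "r = decode_rule r'" using r(1) by blast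
    then obtain y where y: "y \<in> set (snd r')" "fst x = mon (fst y)"
      using r(3) by (auto simp: decode_def)
    then have "16 \<notin> set (fst y)"
      using base_rules_free_of_inverse r'(1) by (auto simp: list_all_iff)
    from lookup_mon_eq_0[OF this] show ?thesis using r(2) y(2) by (simp add: lookup_add)
  qed
  \<comment> \<open>Reduction by the 39 rules alone changes \<open>?p\<close> only by an element of
    \<open>?J0\<close> and never introduces \<open>t\<close>.\<close>
  obtain q where q: "?p - q \<in> ?J0"
    and irr: "\<And>u. u \<in> Poly_Mapping.keys q \<Longrightarrow> \<not> base.reducible TYPE('f) u \<and> Poly_Mapping.lookup u 16 = 0"
    using base.irreducible_representative[of "\<lambda>u. Poly_Mapping.lookup u 16 = 0" ?p] P keys_subst_code_of[of p]
    by blast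
  have "?J0 \<subseteq> ?C"
    using ring.genideal_self[OF ring_from_type_algebra, of "rule_poly ` decode_rule ` rules :: (int, 'f) mpoly set"]
    by (intro ring.genideal_minimal[OF ring_from_type_algebra] ideal_genideal) (auto simp: rules_def)
  then have "q \<in> ?C" using c(6)[OF pC, of "?p - q"] q by auto
  \<comment> \<open>A monomial free of \<open>t\<close> is not divisible by the leading monomial of
    the relation for \<open>t\<close>, so \<open>q\<close> is irreducible for the larger system
    too.\<close>
  moreover have "\<not> grobner.reducible TYPE('f) u" if u: "u \<in> Poly_Mapping.keys q" for u
  proof
    assume "grobner.reducible TYPE('f) u"
    then obtain m r where r: "r \<in> (decode_rule ` rules :: (int, 'f) rule set)" "u = m + fst r"
      unfolding grobner.reducible_def by blast
    then consider "r \<in> ?R" | "r = decode_rule inverse_rule" by (auto simp: rules_def)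
    then show False
    proof cases
      case 1
      then show ?thesis using irr[OF u] r(2) unfolding base.reducible_def by blast
    next
      case 2
      then have "Poly_Mapping.lookup u 16 > 0"
        by (simp add: r(2) inverse_rule_def mon_def lookup_add)
      then show ?thesis using irr[OF u] by simp
    qed
  qed
  ultimately have "q = 0" by (intro grobner.irreducible_in_ideal[OF rules_confluent]) auto
  then have "?p \<in> ?J0" using q by simp
  moreover have "subst (\<lambda>i. Var (coord_of i)) x \<in> J" if "x \<in> rule_poly ` ?R" for x
    using that rules by (auto simp: subst_rule_poly)
  ultimately have "subst (\<lambda>i. Var (coord_of i)) ?p \<in> J"
    using subst_genideal[OF J] by blast
  then show ?thesis by (simp add: subst_subst subst_Var_id)
qed

section \<open>The kernel\<close>

lemma mem_kernel_iff: "p \<in> a_kernel S_ring H0_Z S_to_H0 \<longleftrightarrow> subst Ad_coord p \<in> gnn_ideal"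
proof -
  have "\<zero>\<^bsub>H0_Z\<^esub> = (gnn_ideal :: 'a gnn_poly set)"
    by (simp add: H0_Z_def O_gnn_def FactRing_def)
  also have "\<dots> = a_r_coset ring_of_type_algebra gnn_ideal 0"
    by (auto simp: a_r_coset_def')
  finally show ?thesis
    by (simp add: a_kernel_def' S_to_H0_def coset_eq_iff[OF ideal_gnn_ideal])
qed

text \<open>A characteristic of at least 5 is positive, hence a prime, and no such prime divides
  6.\<close>

lemma six_invertible:
  assumes "CHAR('f::field) \<ge> 5"
  obtains u :: "('v, 'f::field) mpoly" where "u * 6 = 1"
proof
  have "(of_nat 6 :: 'f) \<noteq> 0"
  proof
    assume "(of_nat 6 :: 'f) = 0"
    then have dvd: "CHAR('f) dvd 6" by (simp only: of_nat_eq_0_iff_char_dvd)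
    then have "CHAR('f) \<le> 6" by (rule dvd_imp_le) simp
    then have "CHAR('f) = 5 \<or> CHAR('f) = 6" using assms by linarith
    moreover have "prime (CHAR('f))" using assms by (intro prime_CHAR_semidom) simp
    moreover have "\<not> prime (6::nat)" using prime_nat_iff[of 6] by (auto intro!: exI[of _ 2] simp: dvd_def)
    ultimately show False using dvd by auto
  qed
  then have "inverse (6 :: 'f) * 6 = 1" by simp
  moreover have "(6 :: ('v, 'f) mpoly) = Poly_Mapping.single 0 6"
    using single_of_int[of 6] by simp
  ultimately show "Poly_Mapping.single 0 (inverse 6) * (6 :: ('v, 'f) mpoly) = 1"
    by (simp only: mult_single add_0_left single_one)
qed

section \<open>Degrees of the generators\<close>

lemma sl3_matrix_Var_graded: "sl3_matrix (\<lambda>e. Var (h e)) $ i $ j \<in> graded_piece 1"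
  using exhaust_3[of i] exhaust_3[of j]
  by (auto simp: sl3_matrix_nth intro!: Var_graded_piece graded_piece_diff graded_piece_uminus
      simp del: One_nat_def)

lemma univ_nth_graded: "univ_M $ i $ j \<in> graded_piece 1" "univ_N $ i $ j \<in> graded_piece 1"
  unfolding univ_M_def univ_N_def by (rule sl3_matrix_Var_graded)+

lemma matrix_mult_graded:
  fixes A B :: "('v, 'a::comm_ring_1) mpoly^3^3"
  assumes "\<And>i j. A $ i $ j \<in> graded_piece d" "\<And>i j. B $ i $ j \<in> graded_piece e"
  shows "(A ** B) $ i $ j \<in> graded_piece (d + e)"
  unfolding mult3_nth by (intro graded_piece_add graded_piece_mult assms)

lemma trace_graded: "(\<And>i j. A $ i $ j \<in> graded_piece d) \<Longrightarrow> trace A \<in> graded_piece d"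
  for A :: "('v, 'a::comm_ring_1) mpoly^3^3"
  unfolding trace3 by (intro graded_piece_add)

theorem theorem5p5:
  fixes M N :: "('f::field) S^3^3" and I D2 D3 :: "'f S set"
  assumes "CHAR('f) \<ge> 5"
  defines "M \<equiv> univ_M" and "N \<equiv> univ_N"
  defines "I \<equiv> a_kernel S_ring H0_Z S_to_H0"
  defines "D2 \<equiv> {trace (M ** M), trace (N ** N), trace (M ** N)}"
  defines "D3 \<equiv> {trace (M ** M ** M), trace (N ** N ** N)}
     \<union> (\<Union>A \<in> {M ** M ** N, N ** N ** M, N ** M ** M, M ** N ** N}. {A $ i $ j | i j. True})"
  shows "homogeneous_ideal I \<and> D2 \<subseteq> graded_piece 2 \<and> D3 \<subseteq> graded_piece 3
     \<and> I = genideal S_ring (D2 \<union> D3)"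
proof -
  let ?J = "genideal S_ring (D2 \<union> D3)"
  let ?x = "\<lambda>i. Var (coord_of i) :: 'f S"
  have MN: "gM ?x = M" "gN ?x = N"
    by (simp_all add: M_def N_def univ_M_def univ_N_def)
  have D: "trace (M ** M) \<in> D2 \<union> D3" "trace (N ** N) \<in> D2 \<union> D3" "trace (M ** N) \<in> D2 \<union> D3"
    "trace (M ** M ** M) \<in> D2 \<union> D3" "trace (N ** N ** N) \<in> D2 \<union> D3"
    "(M ** M ** N) $ i $ j \<in> D2 \<union> D3" "(N ** N ** M) $ i $ j \<in> D2 \<union> D3"
    "(N ** M ** M) $ i $ j \<in> D2 \<union> D3" "(M ** N ** N) $ i $ j \<in> D2 \<union> D3" for i j
    unfolding D2_def D3_def by blast+
  have sub: "D2 \<union> D3 \<subseteq> ?J"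
    by (rule ring.genideal_self[OF ring_from_type_algebra]) simp
  note mem = D[THEN subsetD[OF sub]]
  have J: "ideal ?J ring_of_type_algebra" by (rule ideal_genideal)
  obtain u :: "'f S" where u: "u * 6 = 1" using six_invertible[OF assms(1)] by blast
  have rule: "rule_value ?x r \<in> ?J" if "r \<in> set base_rules" for r
    by (rule rule_value_mem[OF J u _ _ _ _ _ _ _ _ _ that]) (simp_all only: MN mem)
  have "I \<subseteq> ?J"
  proof
    fix p assume "p \<in> I"
    then have "subst Ad_coord p \<in> gnn_ideal" by (simp add: I_def mem_kernel_iff)
    from kernel_subset[OF J rule this] show "p \<in> ?J" .
  qed
  moreover have "?J \<subseteq> I"
  proof
    \<comment> \<open>The generators already vanish as polynomials in the entries of a generic
      \<open>g\<close>, without the relation \<open>det g = 1\<close>.\<close>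
    have 0: "subst Ad_coord x = 0" if "x \<in> D2 \<union> D3" for x
    proof -
      note Ad = subst_trace subst_nth map_matrix3_subst M_def N_def map_Ad gnn_U_def gnn_V_def
        trace_conj_n_matrix_mult conj_n_matrix_mult3
      have "trace (0 :: 'f gnn_poly^3^3) = 0" by (simp add: trace3)
      then show ?thesis using that unfolding D2_def D3_def by (auto simp: Ad)
    qed
    fix p assume "p \<in> ?J"
    then have "subst Ad_coord p \<in> gnn_ideal"
      by (rule subst_genideal[OF ideal_gnn_ideal, rotated])
        (simp add: 0 type_ideal_closed(1)[OF ideal_gnn_ideal])
    then show "p \<in> I" by (simp add: I_def mem_kernel_iff)
  qed
  ultimately have I: "I = ?J" by blast
  have g: "M $ i $ j \<in> graded_piece 1" "N $ i $ j \<in> graded_piece 1" for i j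
    unfolding M_def N_def by (rule univ_nth_graded)+
  have 2: "trace (A ** B) \<in> graded_piece 2"
    if "\<And>i j. A $ i $ j \<in> graded_piece 1" "\<And>i j. B $ i $ j \<in> graded_piece 1" for A B :: "'f S^3^3"
    using trace_graded[OF matrix_mult_graded[OF that]] by (simp add: numeral_2_eq_2)
  have 3: "(A ** B ** C) $ i $ j \<in> graded_piece 3"
    if "\<And>i j. A $ i $ j \<in> graded_piece 1" "\<And>i j. B $ i $ j \<in> graded_piece 1"
      "\<And>i j. C $ i $ j \<in> graded_piece 1" for A B C :: "'f S^3^3" and i j
    using matrix_mult_graded[OF matrix_mult_graded[OF that(1,2)] that(3)] by (simp add: numeral_3_eq_3)
  have "D2 \<subseteq> graded_piece 2" unfolding D2_def by (auto intro!: 2 g)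
  moreover have "D3 \<subseteq> graded_piece 3" unfolding D3_def by (auto intro!: trace_graded 3 g)
  moreover have "homogeneous_ideal ?J"
    using calculation by (intro homogeneous_ideal_genideal) blast
  ultimately show ?thesis unfolding I by blast
qed

end
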